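(* Let $\mathbf{A}\in\mathbb{R}^{d\times d}$ satisfy $\|\mathbf{A}\|_2\le1$, and let $\beta=\frac1d\|\mathbf{A}\|_F^2\in[0,1]$. For any positive integer $k<\frac{d}{\beta+1}$, there exist two subsets $\widehat S,\widehat R\subset[d]$ of size $k$ such that $$\|\mathbf{A}_{\widehat S,\widehat R}\|_2\le(1-\beta)\frac kd+2\sqrt{\Big(1-\frac kd\Big)\frac kd\,\beta}.$$
   Context: $[d]=\{1,\dots,d\}$; $\mathbf{A}_{S,R}$ is the submatrix of $\mathbf{A}$ with rows indexed by $S$ and columns indexed by $R$; $\|\cdot\|_2$ is the spectral norm and $\|\cdot\|_F$ the Frobenius norm. *)

theory Defs
  imports Complex_Main
begin

text \<open>A real matrix is represented as a function nat => nat => real; the entries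
 used are those with row index in a finite set S and column index in a finite set R.
 spec_norm S R M is the spectral norm (operator 2-norm) of the submatrix M_{S,R},
 i.e. the supremum of the Euclidean norm of M_{S,R} x over vectors x indexed by R
 with Euclidean norm at most 1.\<close>

definition spec_norm :: "nat set \<Rightarrow> nat set \<Rightarrow> (nat \<Rightarrow> nat \<Rightarrow> real) \<Rightarrow> real" where
  "spec_norm S R M =
     Sup ((\<lambda>x. sqrt (\<Sum>i\<in>S. (\<Sum>j\<in>R. M i j * x j)\<^sup>2)) `
          {x :: nat \<Rightarrow> real. (\<forall>j. j \<notin> R \<longrightarrow> x j = 0) \<and> (\<Sum>j\<in>R. (x j)\<^sup>2) \<le> 1})"

definition frob_norm :: "nat set \<Rightarrow> nat set \<Rightarrow> (nat \<Rightarrow> nat \<Rightarrow> real) \<Rightarrow> real" where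
  "frob_norm S R M = sqrt (\<Sum>i\<in>S. \<Sum>j\<in>R. (M i j)\<^sup>2)"

end

theory Submission
  imports Defs "HOL-Computational_Algebra.Fundamental_Theorem_Algebra" "Jordan_Normal_Form.Determinant"
begin

text \<open>
  The argument is an interlacing-families argument with a barrier bound. Put \<open>n = d - k\<close> and let
  \<open>f\<close> be the characteristic polynomial of \<open>A A\<^sup>T\<close>. Deleting an index from a symmetric matrix gives
  characteristic polynomials which interlace the original one and sum up to its derivative, so
  the average of the characteristic polynomials of \<open>A\<^sub>S\<^sub>,\<^sub>R\<^sup>T A\<^sub>S\<^sub>,\<^sub>R\<close> over all \<open>k\<close>-sets \<open>S\<close> and \<open>R\<close> is
  a multiple of \<open>D\<^sup>n z\<^sup>n D\<^sup>n f\<close>; the factor \<open>z\<^sup>n\<close> comes from passing from \<open>A\<^sub>S A\<^sub>S\<^sup>T\<close> to \<open>A\<^sub>S\<^sup>T A\<^sub>S\<close>.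
  Deleting rows and then columns one at a time, a common interlacing shows that some choice never
  pushes the largest zero beyond that of the average. The largest zero of the average is
  estimated with the logarithmic derivative: if \<open>p'/p \<le> \<phi>\<close> at a point \<open>x\<close> above the zeros of \<open>p\<close>, then
  the same holds for \<open>p'\<close> at \<open>x - 1/\<phi>\<close>. Since the zeros of \<open>f\<close> lie in \<open>[0, 1]\<close> and have mean \<open>\<beta>\<close>,
  optimizing the starting point yields the stated bound.
\<close>

section \<open>Polynomials with linear factors\<close>

abbreviation complex_poly :: "real poly \<Rightarrow> complex poly" where
  "complex_poly \<equiv> map_poly of_real"

lemma complex_poly_pderiv: "complex_poly (pderiv p) = pderiv (complex_poly p)"
  by (rule poly_eqI) (simp add: coeff_map_poly coeff_pderiv)

lemma complex_poly_mult: "complex_poly (p * q) = complex_poly p * complex_poly q"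
  by (rule poly_eqI) (simp add: coeff_map_poly coeff_mult)

lemma complex_poly_add: "complex_poly (p + q) = complex_poly p + complex_poly q"
  by (rule poly_eqI) (simp add: coeff_map_poly)

lemma complex_poly_sum: "complex_poly (\<Sum>i\<in>I. f i) = (\<Sum>i\<in>I. complex_poly (f i))"
  by (induction I rule: infinite_finite_induct) (simp_all add: complex_poly_add)

lemma complex_poly_of_real: "poly (complex_poly p) (of_real x) = of_real (poly p x)"
  by (induction p) (simp_all add: map_poly_pCons)

lemma complex_poly_cnj: "poly (complex_poly p) (cnj z) = cnj (poly (complex_poly p) z)"
  by (induction p) (simp_all add: map_poly_pCons)

lemma degree_complex_poly: "degree (complex_poly p) = degree p"
  by (simp add: degree_map_poly)

lemma complex_poly_inj: "complex_poly p = complex_poly q \<Longrightarrow> p = q"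
  by (metis coeff_map_poly of_real_0 of_real_eq_iff poly_eqI)

lemma linear_factorization:
  fixes p :: "complex poly"
  assumes "p \<noteq> 0"
  obtains r where "p = Polynomial.smult (lead_coeff p) (\<Prod>i<degree p. [:- r i, 1:])"
proof -
  obtain A where A: "size A = degree p" "p = Polynomial.smult (lead_coeff p) (\<Prod>x\<in>#A. [:-x, 1:])"
    using alg_closed_imp_factorization[OF assms] by blast
  obtain xs where xs: "mset xs = A" using ex_mset by blast
  have "(\<Prod>x\<in>#A. [:-x, 1:]) = prod_list (map (\<lambda>x. [:-x, 1:]) xs)"
    unfolding xs[symmetric] by (metis mset_map prod_mset_prod_list)
  also have "\<dots> = (\<Prod>i<length xs. [:- (xs ! i), 1:])"
    by (simp add: prod.list_conv_set_nth atLeast0LessThan)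
  finally have "p = Polynomial.smult (lead_coeff p) (\<Prod>i<degree p. [:- (xs ! i), 1:])"
    using A xs by (metis size_mset)
  then show ?thesis by (rule that)
qed

text \<open>The logarithmic derivative, multiplied out. It is kept generic because it serves over
  the complex numbers for stability and over the reals for the barrier.\<close>

lemma poly_pderiv_linear_factors:
  fixes r :: "nat \<Rightarrow> 'a::{field_char_0}"
  assumes p: "p = Polynomial.smult c (\<Prod>i<N. [:- r i, 1:])" and x: "\<And>i. i < N \<Longrightarrow> x \<noteq> r i"
  shows "poly (pderiv p) x = poly p x * (\<Sum>i<N. 1 / (x - r i))"
proof -
  have "poly (pderiv p) x = c * (\<Sum>i<N. \<Prod>j\<in>{..<N} - {i}. x - r j)"
    by (simp add: p pderiv_smult pderiv_prod poly_sum poly_prod pderiv_pCons)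
  also have "(\<Sum>i<N. \<Prod>j\<in>{..<N} - {i}. x - r j) = (\<Sum>i<N. (\<Prod>j<N. x - r j) * (1 / (x - r i)))"
  proof (rule sum.cong[OF refl])
    fix i assume i: "i \<in> {..<N}"
    have "(\<Prod>j<N. x - r j) = (x - r i) * (\<Prod>j\<in>{..<N} - {i}. x - r j)"
      by (rule prod.remove) (use i in auto)
    then show "(\<Prod>j\<in>{..<N} - {i}. x - r j) = (\<Prod>j<N. x - r j) * (1 / (x - r i))"
      using x i by (simp add: field_simps)
  qed
  finally show ?thesis by (simp add: p poly_prod sum_distrib_left)
qed

section \<open>Stable polynomials and interlacing\<close>

text \<open>Nonreal zeros of a real polynomial come in conjugate pairs, so for real polynomials this
  encodes real-rootedness. The zero polynomial is not stable.\<close>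

definition hp_stable :: "complex poly \<Rightarrow> bool" where
  "hp_stable p \<longleftrightarrow> (\<forall>z. Im z > 0 \<longrightarrow> poly p z \<noteq> 0)"

text \<open>Gauss--Lucas for the half-plane: every summand of the logarithmic derivative has negative
  imaginary part.\<close>

lemma hp_stable_pderiv:
  assumes "hp_stable p" "degree p > 0"
  shows "hp_stable (pderiv p)"
  unfolding hp_stable_def
proof (intro allI impI)
  fix z :: complex assume z: "Im z > 0"
  have "p \<noteq> 0" using assms(2) by auto
  obtain r where r: "p = Polynomial.smult (lead_coeff p) (\<Prod>i<degree p. [:- r i, 1:])"
    using linear_factorization[OF \<open>p \<noteq> 0\<close>] .
  have root: "poly p (r i) = 0" if "i < degree p" for i
    by (subst r) (use that in \<open>auto simp: poly_prod\<close>)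
  have Imr: "Im (r i) \<le> 0" if "i < degree p" for i
    using root[OF that] assms(1) unfolding hp_stable_def by force
  have neg: "Im (1 / (z - r i)) < 0" if "i < degree p" for i
  proof -
    have "z - r i \<noteq> 0" and im: "Im (z - r i) > 0" using z Imr[OF that] by auto
    then have "0 < (Re (z - r i))\<^sup>2 + (Im (z - r i))\<^sup>2"
      by (simp add: add_nonneg_pos)
    then show ?thesis using im by (simp add: Im_divide divide_simps)
  qed
  have "Im (\<Sum>i<degree p. 1 / (z - r i)) < 0"
    using sum_strict_mono[of "{..<degree p}" "\<lambda>i. Im (1 / (z - r i))" "\<lambda>_. 0"] assms(2) neg
    by (simp add: lessThan_empty_iff)
  then have "(\<Sum>i<degree p. 1 / (z - r i)) \<noteq> 0" by (metis less_irrefl zero_complex.simps(2))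
  moreover have "poly p z \<noteq> 0" using assms(1) z by (auto simp: hp_stable_def)
  moreover have "poly (pderiv p) z = poly p z * (\<Sum>i<degree p. 1 / (z - r i))"
    using Imr z by (intro poly_pderiv_linear_factors[OF r]) force
  ultimately show "poly (pderiv p) z \<noteq> 0" by simp
qed

text \<open>A nonreal zero or its conjugate would lie in the upper half-plane; hence all zeros of
  the complex factorization are real and it descends to the reals.\<close>

lemma real_rooted_of_hp_stable:
  fixes p :: "real poly"
  assumes "hp_stable (complex_poly p)" "p \<noteq> 0"
  obtains r :: "nat \<Rightarrow> real" where "p = Polynomial.smult (lead_coeff p) (\<Prod>i<degree p. [:- r i, 1:])"
proof -
  let ?p = "complex_poly p"
  have "?p \<noteq> 0" using assms(2) complex_poly_inj[of p 0] by auto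
  obtain r where r: "?p = Polynomial.smult (lead_coeff ?p) (\<Prod>i<degree ?p. [:- r i, 1:])"
    using linear_factorization[OF \<open>?p \<noteq> 0\<close>] .
  have root: "poly ?p (r i) = 0" if "i < degree p" for i
    by (subst r) (use that in \<open>auto simp: poly_prod degree_complex_poly\<close>)
  have real: "of_real (Re (r i)) = r i" if "i < degree p" for i
  proof -
    have "poly ?p (cnj (r i)) = 0" using root[OF that] by (simp add: complex_poly_cnj)
    then have "Im (r i) = 0" using root[OF that] assms(1) unfolding hp_stable_def
      by (metis cnj.simps(2) linorder_neqE_linordered_idom neg_0_less_iff_less)
    then show ?thesis by (simp add: complex_eq_iff)
  qed
  have lin: "complex_poly [:- a, 1:] = [:- of_real a, 1:]" for a by (simp add: map_poly_pCons)
  have prod: "complex_poly (\<Prod>i\<in>I. [:- s i, 1:]) = (\<Prod>i\<in>I. [:- of_real (s i), 1:])" for I :: "nat set" and s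
    by (induction I rule: infinite_finite_induct)
       (simp_all add: complex_poly_mult lin del: mult_pCons_left)
  have "?p = Polynomial.smult (of_real (lead_coeff p)) (\<Prod>i<degree p. [:- of_real (Re (r i)), 1:])"
    by (subst r) (simp add: degree_complex_poly coeff_map_poly real)
  also have "\<dots> = complex_poly (Polynomial.smult (lead_coeff p) (\<Prod>i<degree p. [:- Re (r i), 1:]))"
    by (simp add: map_poly_smult prod)
  finally have "p = Polynomial.smult (lead_coeff p) (\<Prod>i<degree p. [:- Re (r i), 1:])"
    by (rule complex_poly_inj)
  then show ?thesis by (rule that)
qed

text \<open>For real polynomials with positive leading coefficients and \<open>degree q = degree h - 1\<close> this says
  that the zeros of \<open>q\<close> interlace those of \<open>h\<close>. Phrasing it as a half-plane condition makes it
  linear in \<open>q\<close>.\<close>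

definition interlaces :: "real poly \<Rightarrow> real poly \<Rightarrow> bool" where
  "interlaces q h \<longleftrightarrow> hp_stable (complex_poly h) \<and>
     (\<forall>z. Im z > 0 \<longrightarrow> Im (poly (complex_poly q) z / poly (complex_poly h) z) \<le> 0)"

text \<open>The map \<open>w\<close> to \<open>-1/w\<close> preserves the upper half-plane, so
  \<open>q/h\<close> takes a value there exactly when some \<open>h + w q\<close> vanishes. In this
  form interlacing is inherited through operations on the single polynomial
  \<open>h + w q\<close>.\<close>

lemma interlaces_iff:
  "interlaces q h \<longleftrightarrow> hp_stable (complex_poly h) \<and>
     (\<forall>w. Im w > 0 \<longrightarrow> hp_stable (complex_poly h + Polynomial.smult w (complex_poly q)))"
proof -
  have neg: "Im (- (1 / w)) > 0 \<longleftrightarrow> Im w > 0" for w :: complex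
    by (auto simp: Im_divide zero_less_divide_iff sum_power2_gt_zero_iff not_sum_power2_lt_zero)
  have "(\<forall>z. Im z > 0 \<longrightarrow> Im (poly (complex_poly q) z / poly (complex_poly h) z) \<le> 0) \<longleftrightarrow>
        (\<forall>w. Im w > 0 \<longrightarrow> hp_stable (complex_poly h + Polynomial.smult w (complex_poly q)))" (is "?L \<longleftrightarrow> ?R")
    if h: "hp_stable (complex_poly h)"
  proof
    assume L: ?L
    show ?R unfolding hp_stable_def
    proof (intro allI impI notI)
      fix w z :: complex assume w: "Im w > 0" and z: "Im z > 0"
        and eq: "poly (complex_poly h + Polynomial.smult w (complex_poly q)) z = 0"
      have "w \<noteq> 0" using w by auto
      moreover have "poly (complex_poly h) z \<noteq> 0" using h z by (auto simp: hp_stable_def)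
      ultimately have "poly (complex_poly q) z / poly (complex_poly h) z = - (1 / w)"
        using eq by (simp add: field_simps) (metis add_eq_0_iff)
      with neg[of w] w L z show False by (metis not_le)
    qed
  next
    assume R: ?R
    show ?L
    proof (intro allI impI, rule ccontr)
      fix z :: complex assume z: "Im z > 0"
      let ?q = "poly (complex_poly q) z" and ?h = "poly (complex_poly h) z"
      assume "\<not> Im (?q / ?h) \<le> 0"
      then have pos: "Im (?q / ?h) > 0" and "?q \<noteq> 0" by auto
      have "?h \<noteq> 0" using h z by (auto simp: hp_stable_def)
      \<comment> \<open>The parameter for which \<open>h + w q\<close> vanishes at
        \<open>z\<close>.\<close>
      define w where "w = - (?h / ?q)"
      have "- (1 / w) = ?q / ?h" by (simp add: w_def)
      then have "Im w > 0" using neg[of w] pos by simp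
      then have "poly (complex_poly h + Polynomial.smult w (complex_poly q)) z \<noteq> 0"
        using R z by (auto simp: hp_stable_def)
      then show False using \<open>?q \<noteq> 0\<close> by (simp add: w_def)
    qed
  qed
  then show ?thesis unfolding interlaces_def by blast
qed

lemma interlaces_sum:
  assumes "\<And>i. i \<in> I \<Longrightarrow> interlaces (q i) h" "hp_stable (complex_poly h)"
  shows "interlaces (\<Sum>i\<in>I. q i) h"
  using assms unfolding interlaces_def
  by (auto simp: complex_poly_sum poly_sum sum_divide_distrib intro!: sum_nonpos)

text \<open>Gauss--Lucas is applied to \<open>h + w q\<close>. The degree hypothesis gives this
  polynomial the positive degree of \<open>h\<close> for every \<open>w\<close>.\<close>

lemma interlaces_pderiv:
  assumes "interlaces q h" "degree q < degree h"
  shows "interlaces (pderiv q) (pderiv h)"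
proof -
  have "hp_stable (complex_poly (pderiv h) + Polynomial.smult w (complex_poly (pderiv q)))" if "Im w > 0" for w
  proof -
    have "degree (complex_poly h + Polynomial.smult w (complex_poly q)) = degree h"
      using assms(2) by (metis degree_add_eq_left degree_complex_poly degree_smult_le order.strict_trans1)
    then have "hp_stable (pderiv (complex_poly h + Polynomial.smult w (complex_poly q)))"
      using assms that by (intro hp_stable_pderiv) (auto simp: interlaces_iff)
    then show ?thesis by (simp add: complex_poly_pderiv pderiv_add pderiv_smult)
  qed
  moreover have "hp_stable (complex_poly (pderiv h))"
    unfolding complex_poly_pderiv using assms
    by (intro hp_stable_pderiv) (auto simp: interlaces_def degree_complex_poly)
  ultimately show ?thesis by (simp add: interlaces_iff)
qed

lemma hp_stable_monom_mult:
  assumes "hp_stable (complex_poly p)"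
  shows "hp_stable (complex_poly (monom 1 n * p))"
  using assms by (auto simp: hp_stable_def complex_poly_mult map_poly_monom poly_monom)

lemma interlaces_monom_mult:
  assumes "interlaces q h"
  shows "interlaces (monom 1 n * q) (monom 1 n * h)"
  using assms hp_stable_monom_mult[of h n] unfolding interlaces_def
  by (auto simp: complex_poly_mult map_poly_monom poly_monom)


section \<open>Monotonicity of quotients of interlacing polynomials on the real line\<close>

lemma interlaces_wronskian_nonroot:
  assumes "interlaces q h" "poly h x \<noteq> 0"
  shows "poly (pderiv q) x * poly h x \<le> poly q x * poly (pderiv h) x"
proof -
  let ?q = "poly (complex_poly q)" and ?h = "poly (complex_poly h)"
  define G where "G = (\<lambda>z. ?q z / ?h z)"
  define D where "D = (poly (pderiv q) x * poly h x - poly q x * poly (pderiv h) x) / (poly h x)\<^sup>2"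
  \<comment> \<open>\<open>G\<close> is real at \<open>x\<close> and has nonpositive imaginary part
    above it. The difference quotient in the direction of the imaginary axis therefore has
    nonpositive real part, and its limit is the real derivative \<open>D\<close>.\<close>
  have "(G has_field_derivative of_real D) (at (of_real x))"
    unfolding G_def D_def using assms(2)
    by (auto intro!: derivative_eq_intros
        simp: complex_poly_of_real complex_poly_pderiv[symmetric] power2_eq_square)
  then have "((\<lambda>u. (G (of_real x + u) - G (of_real x)) / u) \<longlongrightarrow> of_real D) (at 0)"
    by (simp add: DERIV_def)
  moreover have "filterlim (\<lambda>\<epsilon>. \<i> * of_real \<epsilon>) (at 0) (at_right (0::real))"
    unfolding filterlim_at
    by (auto intro!: tendsto_eq_intros eventually_at_right_less simp: eventually_at_filter)
  ultimately have "((\<lambda>\<epsilon>. (G (of_real x + \<i> * of_real \<epsilon>) - G (of_real x)) / (\<i> * of_real \<epsilon>))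
      \<longlongrightarrow> of_real D) (at_right 0)"
    by (rule filterlim_compose)
  then have "((\<lambda>\<epsilon>. Re ((G (of_real x + \<i> * of_real \<epsilon>) - G (of_real x)) / (\<i> * of_real \<epsilon>)))
      \<longlongrightarrow> Re (of_real D)) (at_right 0)"
    by (rule tendsto_Re)
  moreover have "Re ((G (of_real x + \<i> * of_real \<epsilon>) - G (of_real x)) / (\<i> * of_real \<epsilon>)) \<le> 0"
    if "\<epsilon> > 0" for \<epsilon>
  proof -
    have "Im (G (of_real x + \<i> * of_real \<epsilon>)) \<le> 0"
      using assms(1) that by (simp add: interlaces_def G_def)
    moreover have "Im (G (of_real x)) = 0"
      by (simp add: G_def complex_poly_of_real flip: of_real_divide)
    ultimately show ?thesis
      using that by (simp add: Re_divide divide_simps power2_eq_square mult_nonneg_nonpos)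
  qed
  ultimately have "D \<le> 0"
    using tendsto_upperbound[of _ D "at_right (0::real)" 0]
    by (simp add: eventually_at_right_less eventually_mono[OF eventually_at_right_less])
  then show ?thesis
    using assms(2) by (simp add: D_def divide_le_0_iff)
qed

text \<open>The zeros of \<open>h\<close> are isolated, so the inequality extends to them by
  continuity.\<close>

lemma interlaces_wronskian:
  assumes "interlaces q h" "h \<noteq> 0"
  shows "poly (pderiv q) x * poly h x \<le> poly q x * poly (pderiv h) x"
proof -
  have "eventually (\<lambda>y. \<forall>a\<in>{a. poly h a = 0}. y \<noteq> a) (at x)"
    using poly_roots_finite[OF assms(2)]
    by (intro eventually_ball_finite) (auto simp: eventually_neq_at_within)
  then have ev: "eventually (\<lambda>y. poly (pderiv q) y * poly h y \<le> poly q y * poly (pderiv h) y) (at x)"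
    by eventually_elim (use interlaces_wronskian_nonroot[OF assms(1)] in auto)
  show ?thesis
    by (rule tendsto_le[OF _ _ _ ev]) (auto intro!: tendsto_intros)
qed

text \<open>Near a zero \<open>x\<close> of \<open>h\<close> of order \<open>m\<close> the quotient behaves like \<open>C / (z - x)^m\<close>, whose
  imaginary part takes both signs on the upper half-plane unless \<open>m = 1\<close>.\<close>

lemma interlaces_simple_root:
  assumes "interlaces f h" "h \<noteq> 0" "poly h x = 0" "poly f x \<noteq> 0"
  shows "poly (pderiv h) x \<noteq> 0"
proof
  assume d0: "poly (pderiv h) x = 0"
  define m where "m = Polynomial.order x h"
  obtain g where g: "h = [:-x, 1:] ^ m * g" "\<not> [:-x, 1:] dvd g"
    unfolding m_def using order_decomp[OF assms(2)] by blast
  have gx: "poly g x \<noteq> 0" using g(2) by (simp add: poly_eq_0_iff_dvd)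
  have "m \<noteq> 0" using g(1) assms(3) gx by (cases "m = 0") auto
  moreover have "m \<noteq> 1"
  proof
    assume "m = 1"
    then have "pderiv h = [:-x, 1:] * pderiv g + g"
      unfolding g(1) by (simp add: pderiv_mult pderiv_pCons del: mult_pCons_left)
    then show False using d0 gx by simp
  qed
  ultimately have m: "m \<ge> 2" by simp
  define C where "C = poly f x / poly g x"
  \<comment> \<open>\<open>x\<close> is approached along the ray at angle \<theta>. After removing
    the positive factor \<open>1 / \<epsilon> ^ m\<close>, the limit of the imaginary part is
    \<open>- C sin (m \<theta>)\<close>.\<close>
  have C: "C * sin (real m * \<theta>) \<ge> 0" if \<theta>: "0 < \<theta>" "\<theta> < pi" for \<theta>
  proof -
    let ?z = "\<lambda>\<epsilon>. complex_of_real x + of_real \<epsilon> * cis \<theta>"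
    let ?Q = "\<lambda>\<epsilon>. poly (complex_poly f) (?z \<epsilon>) / poly (complex_poly g) (?z \<epsilon>)"
    have "(?Q \<longlongrightarrow> poly (complex_poly f) (?z 0) / poly (complex_poly g) (?z 0)) (at_right 0)"
      using gx by (intro tendsto_intros) (auto simp: complex_poly_of_real)
    then have "(?Q \<longlongrightarrow> of_real C) (at_right 0)"
      by (simp add: complex_poly_of_real C_def)
    then have "((\<lambda>\<epsilon>. Im (cis (- (real m * \<theta>)) * ?Q \<epsilon>)) \<longlongrightarrow> Im (cis (- (real m * \<theta>)) * of_real C)) (at_right 0)"
      by (intro tendsto_intros)
    moreover have "Im (cis (- (real m * \<theta>)) * ?Q \<epsilon>) \<le> 0" if "\<epsilon> > 0" for \<epsilon>
    proof -
      have "Im (?z \<epsilon>) > 0" using that \<theta> by (simp add: sin_gt_zero)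
      then have le: "Im (poly (complex_poly f) (?z \<epsilon>) / poly (complex_poly h) (?z \<epsilon>)) \<le> 0"
        using assms(1) unfolding interlaces_def by blast
      have lin: "poly (complex_poly ([:-x, 1:] ^ n)) z = (z - of_real x) ^ n" for n z
        by (induction n) (simp_all add: complex_poly_mult map_poly_pCons algebra_simps del: mult_pCons_left)
      have "poly (complex_poly h) (?z \<epsilon>) = (of_real \<epsilon> * cis \<theta>) ^ m * poly (complex_poly g) (?z \<epsilon>)"
        by (simp add: g(1) complex_poly_mult lin)
      also have "\<dots> = of_real (\<epsilon> ^ m) * (cis (real m * \<theta>) * poly (complex_poly g) (?z \<epsilon>))"
        by (simp add: power_mult_distrib DeMoivre)
      finally have "poly (complex_poly f) (?z \<epsilon>) / poly (complex_poly h) (?z \<epsilon>)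
          = of_real (1 / \<epsilon> ^ m) * (cis (- (real m * \<theta>)) * ?Q \<epsilon>)"
        by (simp add: cis_inverse[symmetric] divide_simps del: cis_inverse)
      then have "Im (poly (complex_poly f) (?z \<epsilon>) / poly (complex_poly h) (?z \<epsilon>))
          = (1 / \<epsilon> ^ m) * Im (cis (- (real m * \<theta>)) * ?Q \<epsilon>)"
        by (simp only: times_complex.sel Re_complex_of_real Im_complex_of_real mult_zero_left add_0_right)
      then have "(1 / \<epsilon> ^ m) * Im (cis (- (real m * \<theta>)) * ?Q \<epsilon>) \<le> 0" using le by simp
      moreover have "1 / \<epsilon> ^ m > 0" using that by simp
      ultimately show ?thesis by (meson mult_pos_pos not_le)
    qed
    ultimately have "Im (cis (- (real m * \<theta>)) * of_real C) \<le> 0"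
      by (intro tendsto_upperbound[of _ _ "at_right (0::real)"])
         (auto intro: eventually_mono[OF eventually_at_right_less])
    then show ?thesis by (simp add: mult.commute)
  qed
  \<comment> \<open>The angles \<open>pi / (2 m)\<close> and \<open>3 pi / (2 m)\<close> make the
    sine \<open>1\<close> and \<open>-1\<close>; the second one is below \<open>pi\<close> because
    \<open>m \<ge> 2\<close>.\<close>
  have "C \<ge> 0"
    using C[of "pi / (2 * m)"] m by (simp add: field_simps)
  moreover have "sin (3 * pi / 2) = -1"
    using sin_3over2_pi by (simp add: mult.commute)
  then have "C \<le> 0"
    using C[of "3 * pi / (2 * m)"] m by (simp add: field_simps)
  ultimately show False
    using gx assms(4) by (simp add: C_def)
qed

lemma poly_eventually_pos:
  fixes p :: "real poly"
  assumes "lead_coeff p > 0"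
  obtains N where "\<And>x. x \<ge> N \<Longrightarrow> poly p x > 0"
  using poly_pinfty_gt_lc[OF assms] assms by (metis less_le_trans)

text \<open>This is where a common interlacing polynomial \<open>h\<close> is exploited: at most one zero of \<open>h\<close> lies in
  \<open>[t, \<infinity>)\<close>, so \<open>q\<close> has at most one zero there, and positivity at \<open>t\<close> excludes it.\<close>

lemma interlaces_pos_propagate:
  assumes f: "interlaces f h" and q: "interlaces q h"
    and lh: "lead_coeff h > 0" and lq: "lead_coeff q > 0"
    and fpos: "\<And>x. x \<ge> t \<Longrightarrow> poly f x > 0" and qt: "poly q t > 0" and yt: "y \<ge> t"
  shows "poly q y > 0"
proof -
  have h0: "h \<noteq> 0" using lh by auto
  \<comment> \<open>By the Wronskian inequality \<open>q/h\<close> decreases between zeros of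
    \<open>h\<close>, while \<open>h/f\<close> increases wherever \<open>f\<close> is
    positive.\<close>
  have dec: "poly q b / poly h b \<le> poly q a / poly h a"
    if "a \<le> b" "\<And>x. a \<le> x \<Longrightarrow> x \<le> b \<Longrightarrow> poly h x \<noteq> 0" for a b
  proof (rule DERIV_nonpos_imp_nonincreasing[OF that(1)])
    fix x assume x: "a \<le> x" "x \<le> b"
    have "((\<lambda>x. poly q x / poly h x) has_real_derivative
        (poly (pderiv q) x * poly h x - poly q x * poly (pderiv h) x) / (poly h x * poly h x)) (at x)"
      using that(2)[OF x] by (auto intro!: derivative_eq_intros)
    moreover have "(poly (pderiv q) x * poly h x - poly q x * poly (pderiv h) x) / (poly h x * poly h x) \<le> 0"
      using interlaces_wronskian[OF q h0, of x] by (intro divide_nonpos_nonneg) auto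
    ultimately show "\<exists>y. ((\<lambda>x. poly q x / poly h x) has_real_derivative y) (at x) \<and> y \<le> 0" by blast
  qed
  have inc: "poly h a / poly f a \<le> poly h b / poly f b" if "t \<le> a" "a \<le> b" for a b
  proof (rule DERIV_nonneg_imp_nondecreasing[OF that(2)])
    fix x assume x: "a \<le> x" "x \<le> b"
    have "((\<lambda>x. poly h x / poly f x) has_real_derivative
        (poly (pderiv h) x * poly f x - poly h x * poly (pderiv f) x) / (poly f x * poly f x)) (at x)"
      using fpos[of x] x that by (auto intro!: derivative_eq_intros)
    moreover have "(poly (pderiv h) x * poly f x - poly h x * poly (pderiv f) x) / (poly f x * poly f x) \<ge> 0"
      using interlaces_wronskian[OF f h0, of x] by (intro divide_nonneg_nonneg) (auto simp: mult.commute)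
    ultimately show "\<exists>y. ((\<lambda>x. poly h x / poly f x) has_real_derivative y) (at x) \<and> 0 \<le> y" by blast
  qed
  \<comment> \<open>To the right of all zeros of \<open>h\<close> the quotient \<open>q/h\<close> is
    decreasing and eventually positive, hence positive throughout.\<close>
  have right: "poly q y > 0" if "\<And>x. x \<ge> y \<Longrightarrow> poly h x > 0" for y
  proof -
    obtain N where N: "\<And>x. x \<ge> N \<Longrightarrow> poly q x > 0" using poly_eventually_pos[OF lq] by blast
    have "poly q (max N y) / poly h (max N y) \<le> poly q y / poly h y"
      using that by (intro dec) (auto simp: less_imp_neq[symmetric] dest: that)
    moreover have "0 < poly q (max N y) / poly h (max N y)"
      using N that by (intro divide_pos_pos) auto
    ultimately have "0 < poly q y / poly h y" by linarith
    then show ?thesis using that[of y] by (simp add: zero_less_divide_iff)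
  qed
  show ?thesis
  proof (cases "\<exists>x\<ge>t. poly h x = 0")
    case False
    have "poly h x > 0" if "x \<ge> y" for x
    proof (rule ccontr)
      assume "\<not> poly h x > 0"
      then have neg: "poly h x < 0" using False that yt by (meson linorder_neqE_linordered_idom order_trans)
      obtain N where N: "\<And>x. x \<ge> N \<Longrightarrow> poly h x > 0" using poly_eventually_pos[OF lh] by blast
      have "poly h (max N (x + 1)) > 0" "x < max N (x + 1)" using N by auto
      then obtain z where "x < z" "poly h z = 0" using poly_IVT_pos[OF _ neg] by blast
      then show False using False that yt by (meson less_imp_le order_trans)
    qed
    then show ?thesis by (rule right)
  next
    case True
    then obtain x1 where x1: "x1 \<ge> t" "poly h x1 = 0" by blast
    \<comment> \<open>Two zeros of \<open>h\<close> beyond \<open>t\<close> would force the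
      increasing quotient \<open>h/f\<close> to vanish on the whole interval between them.\<close>
    have uniq: "a = b" if "t \<le> a" "a \<le> b" "poly h a = 0" "poly h b = 0" for a b
    proof (rule ccontr)
      assume "a \<noteq> b"
      have "poly h x = 0" if x: "x \<in> {a..b}" for x
      proof -
        have "poly h x / poly f x = 0"
          using inc[of a x] inc[of x b] x \<open>t \<le> a\<close> \<open>poly h a = 0\<close> \<open>poly h b = 0\<close> by simp
        then show ?thesis using fpos[of x] x \<open>t \<le> a\<close> by auto
      qed
      then have "{a..b} \<subseteq> {x. poly h x = 0}" by auto
      then have "finite {a..b}" using poly_roots_finite[OF h0] finite_subset by blast
      then show False using \<open>a \<le> b\<close> \<open>a \<noteq> b\<close> infinite_Icc[of a b] by simp
    qed
    have hr: "poly h x > 0" if "x > x1" for x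
    proof -
      have "0 \<le> poly h x / poly f x" using inc[of x1 x] x1 that by simp
      then have "poly h x \<ge> 0" using fpos[of x] x1 that by (simp add: zero_le_divide_iff)
      moreover have "poly h x \<noteq> 0" using uniq[of x1 x] x1 that by auto
      ultimately show ?thesis by simp
    qed
    have hl: "poly h x < 0" if "t \<le> x" "x < x1" for x
    proof -
      have "poly h x / poly f x \<le> 0" using inc[of x x1] x1 that by simp
      then have "poly h x \<le> 0" using fpos[of x] x1 that by (simp add: divide_le_0_iff)
      moreover have "poly h x \<noteq> 0" using uniq[of x x1] x1 that by auto
      ultimately show ?thesis by simp
    qed
    have qr: "poly q x > 0" if "x > x1" for x
      by (rule right) (use hr that in auto)
    have ql: "poly q x / poly h x \<le> poly q t / poly h t" if "t \<le> x" "x < x1" for x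
      by (rule dec) (use hl that in \<open>force+\<close>)
    consider "y > x1" | "y < x1" | "y = x1" "t = x1" | "y = x1" "t < x1" using yt x1 by linarith
    then show ?thesis
    proof cases
      case 2
      have "poly q t / poly h t < 0" using qt hl[of t] 2 yt by (simp add: divide_pos_neg)
      then have "poly q y / poly h y < 0" using ql[of y] yt 2 by linarith
      then show ?thesis using hl[of y] yt 2 by (simp add: divide_less_0_iff)
    next
      case 4
      have "0 \<le> poly q x1"
      proof (rule tendsto_lowerbound)
        show "(poly q \<longlongrightarrow> poly q x1) (at_right x1)" by (auto intro!: tendsto_intros)
        show "\<forall>\<^sub>F x in at_right x1. 0 \<le> poly q x"
          using qr by (auto intro!: eventually_mono[OF eventually_at_right_less] less_imp_le)
      qed auto
      \<comment> \<open>If \<open>q\<close> vanished at the zero \<open>x1\<close> of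
        \<open>h\<close>, which is simple, then \<open>q/h\<close> would extend continuously across
        \<open>x1\<close>. Its value there would be nonnegative from the right, but at most the
        negative number \<open>q(t)/h(t)\<close> from the left.\<close>
      moreover have "poly q x1 \<noteq> 0"
      proof
        assume "poly q x1 = 0"
        then obtain q1 where q1: "q = [:-x1, 1:] * q1" by (auto simp: poly_eq_0_iff_dvd dvd_def)
        obtain h1 where h1: "h = [:-x1, 1:] * h1" using x1 by (auto simp: poly_eq_0_iff_dvd dvd_def)
        have "poly (pderiv h) x1 \<noteq> 0"
          using interlaces_simple_root[OF f h0 x1(2)] fpos[OF x1(1)] by auto
        then have "poly h1 x1 \<noteq> 0" unfolding h1 by (simp add: pderiv_mult pderiv_pCons del: mult_pCons_left)
        then have lim: "((\<lambda>x. poly q1 x / poly h1 x) \<longlongrightarrow> poly q1 x1 / poly h1 x1) (at x1 within U)" for U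
          by (auto intro!: tendsto_intros)
        have eq: "poly q1 x / poly h1 x = poly q x / poly h x" if "x \<noteq> x1" for x
          using that by (simp add: q1 h1 del: mult_pCons_left)
        have "poly q1 x1 / poly h1 x1 \<ge> 0"
          using qr hr eq
          by (intro tendsto_lowerbound[OF lim[of "{x1<..}"]])
             (auto intro!: eventually_mono[OF eventually_at_right_less] divide_nonneg_nonneg less_imp_le)
        moreover have "poly q1 x1 / poly h1 x1 \<le> poly q t / poly h t"
        proof (rule tendsto_upperbound[OF lim[of "{..<x1}"]])
          show "\<forall>\<^sub>F x in at_left x1. poly q1 x / poly h1 x \<le> poly q t / poly h t"
            unfolding eventually_at_left_field
            using 4(2) ql eq by (intro exI[of _ t]) auto
        qed auto
        moreover have "poly q t / poly h t < 0" using qt hl[of t] 4 by (simp add: divide_pos_neg)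
        ultimately show False by linarith
      qed
      ultimately show ?thesis using 4 by simp
    qed (use qr qt in auto)
  qed
qed

section \<open>The barrier argument\<close>

lemma poly_pderiv2_linear_factors:
  fixes r :: "nat \<Rightarrow> real"
  assumes p: "p = Polynomial.smult c (\<Prod>i<N. [:- r i, 1:])" and x: "\<And>i. i < N \<Longrightarrow> r i < x"
  shows "poly (pderiv (pderiv p)) x = poly p x * ((\<Sum>i<N. 1 / (x - r i))\<^sup>2 - (\<Sum>i<N. 1 / (x - r i)\<^sup>2))"
proof -
  have px: "poly (pderiv p) x = poly p x * (\<Sum>i<N. 1 / (x - r i))"
    using x by (intro poly_pderiv_linear_factors[OF p]) force
  have "\<forall>\<^sub>F y in nhds x. \<forall>i\<in>{..<N}. r i < y"
    by (intro eventually_ball_finite) (use x in \<open>auto intro: eventually_nhds_in_open[of "{r _<..}", simplified]\<close>)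
  then have ev: "\<forall>\<^sub>F y in nhds x. poly (pderiv p) y = poly p y * (\<Sum>i<N. 1 / (y - r i))"
    by eventually_elim (intro poly_pderiv_linear_factors[OF p], force)
  have "((\<lambda>y. poly p y * (\<Sum>i<N. 1 / (y - r i))) has_field_derivative
      poly (pderiv p) x * (\<Sum>i<N. 1 / (x - r i)) + (\<Sum>i<N. - (1 / (x - r i)\<^sup>2)) * poly p x) (at x)"
    using x by (auto intro!: derivative_eq_intros sum.cong simp: power2_eq_square) force
  then have "(poly (pderiv p) has_field_derivative
      poly (pderiv p) x * (\<Sum>i<N. 1 / (x - r i)) + (\<Sum>i<N. - (1 / (x - r i)\<^sup>2)) * poly p x) (at x)"
    by (rule iffD2[OF DERIV_cong_ev[OF refl ev refl]])
  from DERIV_unique[OF poly_DERIV this]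
  have "poly (pderiv (pderiv p)) x
      = poly (pderiv p) x * (\<Sum>i<N. 1 / (x - r i)) + (\<Sum>i<N. - (1 / (x - r i)\<^sup>2)) * poly p x" .
  then show ?thesis unfolding px
    by (simp add: sum_negf power2_eq_square algebra_simps)
qed

lemma lead_coeff_pderiv_pos:
  fixes p :: "real poly"
  assumes "lead_coeff p > 0" "degree p > 0"
  shows "lead_coeff (pderiv p) > 0"
  using assms by (simp add: degree_pderiv coeff_pderiv)

lemma barrier_step:
  fixes p :: "real poly"
  assumes st: "hp_stable (complex_poly p)" and lc: "lead_coeff p > 0" and deg: "degree p \<ge> 2"
    and pos: "\<And>x. x \<ge> b \<Longrightarrow> poly p x > 0" and \<phi>: "\<phi> > 0"
    and bar: "poly (pderiv p) b \<le> \<phi> * poly p b"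
  shows "(\<forall>x\<ge>b - 1 / \<phi>. poly (pderiv p) x > 0) \<and>
    poly (pderiv (pderiv p)) (b - 1 / \<phi>) \<le> \<phi> * poly (pderiv p) (b - 1 / \<phi>)"
proof -
  define N where "N = degree p"
  define \<delta> where "\<delta> = 1 / \<phi>"
  define t where "t = b - \<delta>"
  have \<delta>: "\<delta> > 0" using \<phi> by (simp add: \<delta>_def)
  have "p \<noteq> 0" using lc by auto
  then obtain r where r: "p = Polynomial.smult (lead_coeff p) (\<Prod>i<N. [:- r i, 1:])"
    unfolding N_def using real_rooted_of_hp_stable[OF st] by blast
  have root: "poly p (r i) = 0" if "i < N" for i
    by (subst r) (use that in \<open>auto simp: poly_prod\<close>)
  have rb: "r i < b" if "i < N" for i
    using root[OF that] pos[of "r i"] by (metis less_irrefl not_le)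
  have "poly p b * (\<Sum>i<N. 1 / (b - r i)) \<le> poly p b * \<phi>"
    using bar poly_pderiv_linear_factors[OF r, of b] rb by (force simp: mult.commute)
  then have S: "(\<Sum>i<N. 1 / (b - r i)) \<le> \<phi>"
    using pos[of b] by simp
  \<comment> \<open>As there are at least two zeros, a single summand is strictly below \<phi>, so
    every zero is further than \<open>1 / \<phi>\<close> from \<open>b\<close>.\<close>
  have rt: "r i < t" if i: "i < N" for i
  proof -
    obtain j where j: "j < N" "j \<noteq> i"
      using deg by (metis N_def One_nat_def less_2_cases_iff less_le_trans zero_neq_one)
    have "1 / (b - r i) < 1 / (b - r i) + 1 / (b - r j)"
      using rb[OF j(1)] by simp
    also have "\<dots> = (\<Sum>i\<in>{i, j}. 1 / (b - r i))" using j by simp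
    also have "\<dots> \<le> (\<Sum>i<N. 1 / (b - r i))"
      using i j rb by (intro sum_mono2) (auto simp: less_imp_le)
    finally have "1 / (b - r i) < \<phi>" using S by simp
    then show ?thesis using rb[OF i] \<phi> by (simp add: t_def \<delta>_def field_simps)
  qed
  have ppos: "poly p x > 0" if "x \<ge> t" for x
    by (subst r) (use that rt lc in \<open>force simp: poly_prod intro!: mult_pos_pos prod_pos\<close>)
  have dpos: "poly (pderiv p) x > 0" if "x \<ge> t" for x
  proof -
    have "poly (pderiv p) x = poly p x * (\<Sum>i<N. 1 / (x - r i))"
      using rt that by (intro poly_pderiv_linear_factors[OF r]) force
    moreover have "(\<Sum>i<N. 1 / (x - r i)) > 0"
      using rt that deg by (intro sum_pos) (force simp: N_def lessThan_empty_iff)+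
    ultimately show ?thesis using ppos[OF that] by simp
  qed
  text \<open>With \<open>c\<^sub>i = \<delta> / (t - r\<^sub>i)\<close> the hypothesis reads \<open>\<Sum> c\<^sub>i / (1 + c\<^sub>i) \<le> 1\<close>, and the claim
    \<open>(\<Sum> c\<^sub>i)\<^sup>2 \<le> \<Sum> c\<^sub>i (1 + c\<^sub>i)\<close> follows by Cauchy--Schwarz.\<close>
  define c where "c = (\<lambda>i. \<delta> / (t - r i))"
  define X where "X = (\<Sum>i<N. c i)"
  have c: "c i > 0" if "i < N" for i using rt[OF that] \<delta> by (simp add: c_def)
  have "c i / (1 + c i) = \<delta> * (1 / (b - r i))" if "i < N" for i
  proof -
    have nz: "t - r i \<noteq> 0" "b - r i \<noteq> 0" using rt[OF that] rb[OF that] by auto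
    then have "1 + c i = (b - r i) / (t - r i)" by (simp add: c_def t_def field_simps)
    then show ?thesis using nz by (simp add: c_def)
  qed
  then have "(\<Sum>i<N. c i / (1 + c i)) = \<delta> * (\<Sum>i<N. 1 / (b - r i))"
    by (simp add: sum_distrib_left)
  also have "\<dots> \<le> \<delta> * \<phi>" using S \<delta> by (intro mult_left_mono) auto
  finally have W: "(\<Sum>i<N. c i / (1 + c i)) \<le> 1" using \<phi> by (simp add: \<delta>_def)
  \<comment> \<open>Cauchy--Schwarz with weights, in the form of an expanded square; summation
    leaves \<open>X\<^sup>2\<close> on the left after using
    \<open>\<Sum> c\<^sub>i / (1 + c\<^sub>i) \<le> 1\<close>.\<close>
  have amgm: "2 * X * c i \<le> X\<^sup>2 * (c i / (1 + c i)) + c i * (1 + c i)" if "i < N" for i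
  proof -
    have "0 \<le> (c i / (1 + c i)) * (X - (1 + c i))\<^sup>2" using c[OF that] by simp
    also have "\<dots> = X\<^sup>2 * (c i / (1 + c i)) + c i * (1 + c i) - 2 * X * c i"
      using c[OF that] by (simp add: field_simps power2_eq_square)
    finally show ?thesis by simp
  qed
  have "2 * X * X \<le> X\<^sup>2 * (\<Sum>i<N. c i / (1 + c i)) + (\<Sum>i<N. c i * (1 + c i))"
  proof -
    have "2 * X * X = (\<Sum>i<N. 2 * X * c i)" by (simp only: sum_distrib_left[symmetric] X_def[symmetric])
    also have "\<dots> \<le> (\<Sum>i<N. X\<^sup>2 * (c i / (1 + c i)) + c i * (1 + c i))"
      by (rule sum_mono) (use amgm in auto)
    also have "\<dots> = X\<^sup>2 * (\<Sum>i<N. c i / (1 + c i)) + (\<Sum>i<N. c i * (1 + c i))"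
      by (simp only: sum_distrib_left[symmetric] sum.distrib)
    finally show ?thesis .
  qed
  also have "\<dots> \<le> X\<^sup>2 * 1 + (\<Sum>i<N. c i * (1 + c i))"
    using W by (intro add_right_mono mult_left_mono) auto
  also have "(\<Sum>i<N. c i * (1 + c i)) = X + (\<Sum>i<N. (c i)\<^sup>2)"
    by (simp add: X_def algebra_simps sum.distrib power2_eq_square)
  finally have key: "X\<^sup>2 - (\<Sum>i<N. (c i)\<^sup>2) \<le> X" by (simp add: power2_eq_square)
  have cX: "c i = \<delta> * (1 / (t - r i))" for i by (simp add: c_def)
  have "\<delta>\<^sup>2 * ((\<Sum>i<N. 1 / (t - r i))\<^sup>2 - (\<Sum>i<N. 1 / (t - r i)\<^sup>2)) \<le> \<delta>\<^sup>2 * (\<phi> * (\<Sum>i<N. 1 / (t - r i)))"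
  proof -
    have "X = \<delta> * (\<Sum>i<N. 1 / (t - r i))"
      unfolding X_def cX sum_distrib_left ..
    moreover have "(\<Sum>i<N. (c i)\<^sup>2) = \<delta>\<^sup>2 * (\<Sum>i<N. 1 / (t - r i)\<^sup>2)"
      unfolding cX sum_distrib_left by (simp add: power_mult_distrib power_one_over power_divide)
    moreover have "\<delta>\<^sup>2 * (\<phi> * (\<Sum>i<N. 1 / (t - r i))) = \<delta> * (\<Sum>i<N. 1 / (t - r i))" using \<phi> by (simp add: \<delta>_def power2_eq_square)
    ultimately show ?thesis
      using key by (simp only: power_mult_distrib right_diff_distrib)
  qed
  then have "(\<Sum>i<N. 1 / (t - r i))\<^sup>2 - (\<Sum>i<N. 1 / (t - r i)\<^sup>2) \<le> \<phi> * (\<Sum>i<N. 1 / (t - r i))"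
    using \<delta> by simp
  then have "poly p t * ((\<Sum>i<N. 1 / (t - r i))\<^sup>2 - (\<Sum>i<N. 1 / (t - r i)\<^sup>2))
      \<le> poly p t * (\<phi> * (\<Sum>i<N. 1 / (t - r i)))"
    using ppos[of t] by (intro mult_left_mono) auto
  moreover have "poly (pderiv p) t = poly p t * (\<Sum>i<N. 1 / (t - r i))"
    using rt by (intro poly_pderiv_linear_factors[OF r]) force
  moreover have "poly (pderiv (pderiv p)) t = poly p t * ((\<Sum>i<N. 1 / (t - r i))\<^sup>2 - (\<Sum>i<N. 1 / (t - r i)\<^sup>2))"
    by (rule poly_pderiv2_linear_factors[OF r rt])
  ultimately show ?thesis
    using dpos unfolding t_def \<delta>_def by (auto simp: algebra_simps)
qed

section \<open>Iterating the barrier step, with exact control of degrees\<close>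

definition pos_real_rooted :: "nat \<Rightarrow> real poly \<Rightarrow> bool" where
  "pos_real_rooted m p \<longleftrightarrow> hp_stable (complex_poly p) \<and> degree p = m \<and> lead_coeff p > 0"

lemma pos_real_rooted_pderiv:
  assumes "pos_real_rooted (Suc m) p"
  shows "pos_real_rooted m (pderiv p)"
  using assms hp_stable_pderiv[of "complex_poly p"] lead_coeff_pderiv_pos[of p]
  by (auto simp: pos_real_rooted_def degree_pderiv complex_poly_pderiv degree_complex_poly)

lemma pos_real_rooted_pderiv_funpow:
  assumes "pos_real_rooted (m + n) p"
  shows "pos_real_rooted m ((pderiv ^^ n) p)"
  using assms
proof (induction n arbitrary: m)
  case (Suc n)
  then show ?case using Suc.IH[of "Suc m"] pos_real_rooted_pderiv by simp
qed simp

lemma pos_real_rooted_monom_mult: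
  assumes "pos_real_rooted m p"
  shows "pos_real_rooted (n + m) (monom 1 n * p)"
proof -
  have "p \<noteq> 0" using assms by (auto simp: pos_real_rooted_def)
  then have "degree (monom 1 n * p) = n + degree p" 
    by (subst degree_mult_eq) (auto simp: degree_monom_eq)
  moreover have "lead_coeff (monom 1 n * p) = lead_coeff p"
    by (subst lead_coeff_mult) (simp add: degree_monom_eq)
  ultimately show ?thesis
    using assms hp_stable_monom_mult[of p n] by (auto simp: pos_real_rooted_def)
qed

text \<open>The conclusion of \<open>barrier_step\<close> has the form of its hypotheses at the
  shifted point. Since \<open>m \<ge> 1\<close>, every polynomial being differentiated has degree at
  least two.\<close>

lemma barrier_funpow:
  assumes "pos_real_rooted (m + n) p" "m \<ge> 1"
    and "\<And>x. x \<ge> b \<Longrightarrow> poly p x > 0" and "\<phi> > 0"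
    and "poly (pderiv p) b \<le> \<phi> * poly p b"
  shows "(\<forall>x\<ge>b - n / \<phi>. poly ((pderiv ^^ n) p) x > 0) \<and>
    poly (pderiv ((pderiv ^^ n) p)) (b - n / \<phi>) \<le> \<phi> * poly ((pderiv ^^ n) p) (b - n / \<phi>)"
  using assms
proof (induction n arbitrary: m)
  case (Suc n)
  have IH: "(\<forall>x\<ge>b - n / \<phi>. poly ((pderiv ^^ n) p) x > 0) \<and>
    poly (pderiv ((pderiv ^^ n) p)) (b - n / \<phi>) \<le> \<phi> * poly ((pderiv ^^ n) p) (b - n / \<phi>)"
    using Suc.prems by (intro Suc.IH[of "Suc m"]) auto
  have "pos_real_rooted (Suc m) ((pderiv ^^ n) p)"
    using pos_real_rooted_pderiv_funpow[of "Suc m" n p] Suc.prems(1) by simp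
  then have "(\<forall>x\<ge>(b - n / \<phi>) - 1 / \<phi>. poly (pderiv ((pderiv ^^ n) p)) x > 0) \<and>
    poly (pderiv (pderiv ((pderiv ^^ n) p))) ((b - n / \<phi>) - 1 / \<phi>)
      \<le> \<phi> * poly (pderiv ((pderiv ^^ n) p)) ((b - n / \<phi>) - 1 / \<phi>)"
    using IH Suc.prems by (intro barrier_step) (auto simp: pos_real_rooted_def)
  moreover have "(b - n / \<phi>) - 1 / \<phi> = b - Suc n / \<phi>" by (simp add: add_divide_distrib)
  ultimately show ?case by simp
qed auto

text \<open>The point moves first from \<open>u\<^sup>2\<close> to \<open>u (u - n/\<phi>)\<close> and then to \<open>(u - n/\<phi>)\<^sup>2\<close>. The factor
  \<open>z\<^sup>n\<close> raises the logarithmic derivative there exactly from \<open>\<phi>/u\<close> to \<open>\<phi>/(u - n/\<phi>)\<close>.\<close>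

lemma barrier_two_sided:
  fixes f :: "real poly"
  assumes f: "pos_real_rooted (m + n) f" and m: "m \<ge> 1" and \<phi>: "\<phi> > 0" and u: "u > 0" and b: "u - n / \<phi> > 0"
    and pos: "\<And>x. x \<ge> u\<^sup>2 \<Longrightarrow> poly f x > 0"
    and bar: "u * poly (pderiv f) (u\<^sup>2) \<le> \<phi> * poly f (u\<^sup>2)"
  shows "\<forall>x\<ge>(u - n / \<phi>)\<^sup>2. poly ((pderiv ^^ n) (monom 1 n * (pderiv ^^ n) f)) x > 0"
proof -
  define b where "b = u - n / \<phi>"
  define T where "T = (pderiv ^^ n) f"
  define P where "P = monom 1 n * T"
  have b: "b > 0" using \<open>u - n / \<phi> > 0\<close> by (simp add: b_def)
  have T: "pos_real_rooted m T" using pos_real_rooted_pderiv_funpow[OF f] by (simp add: T_def)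
  have P: "pos_real_rooted (m + n) P" using pos_real_rooted_monom_mult[OF T, of n] by (simp add: P_def add.commute)
  have e1: "u\<^sup>2 - n / (\<phi> / u) = u * b" using u by (simp add: b_def power2_eq_square algebra_simps)
  have "(\<forall>x\<ge>u\<^sup>2 - n / (\<phi> / u). poly T x > 0) \<and>
    poly (pderiv T) (u\<^sup>2 - n / (\<phi> / u)) \<le> \<phi> / u * poly T (u\<^sup>2 - n / (\<phi> / u))"
    unfolding T_def using bar u \<phi>
    by (intro barrier_funpow[OF f m pos]) (auto simp: field_simps)
  then have Tpos: "\<And>x. x \<ge> u * b \<Longrightarrow> poly T x > 0"
    and Tbar: "poly (pderiv T) (u * b) \<le> \<phi> / u * poly T (u * b)"
    unfolding e1 by auto
  have ub: "u * b > 0" using u b by simp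
  have Ppos: "poly P x > 0" if "x \<ge> u * b" for x
    using Tpos[OF that] ub that by (simp add: P_def poly_monom)
  have "poly (pderiv P) (u * b) = (u * b) ^ n * (n / (u * b) * poly T (u * b) + poly (pderiv T) (u * b))"
  proof -
    have "poly (pderiv (monom 1 n)) v = v ^ n * (n / v)" if "v > 0" for v :: real
      using that by (cases n) (simp_all add: pderiv_monom poly_monom field_simps)
    from this[OF ub] show ?thesis
      by (simp add: P_def pderiv_mult poly_monom algebra_simps)
  qed
  also have "\<dots> \<le> (u * b) ^ n * (n / (u * b) * poly T (u * b) + \<phi> / u * poly T (u * b))"
    using Tbar ub by (intro mult_left_mono add_left_mono) auto
  also have "\<dots> = (n / (u * b) + \<phi> / u) * poly P (u * b)"
    by (simp add: P_def poly_monom algebra_simps)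
  also have "n / (u * b) + \<phi> / u = (n + \<phi> * b) / (u * b)"
    using u b by (simp add: field_simps)
  also have "n + \<phi> * b = \<phi> * u" using \<phi> by (simp add: b_def field_simps)
  also have "\<phi> * u / (u * b) = \<phi> / b" using u by simp
  finally have Pbar: "poly (pderiv P) (u * b) \<le> \<phi> / b * poly P (u * b)" .
  have "\<forall>x\<ge>u * b - n / (\<phi> / b). poly ((pderiv ^^ n) P) x > 0"
    using barrier_funpow[OF P m Ppos _ Pbar] \<phi> b by simp
  moreover have "u * b - n / (\<phi> / b) = (u - n / \<phi>) * b" by (simp add: algebra_simps)
  then have "u * b - n / (\<phi> / b) = b\<^sup>2" by (simp only: b_def[symmetric] power2_eq_square)
  ultimately show ?thesis by (simp add: b_def P_def T_def)
qed

section \<open>Determinants and characteristic polynomials of principal submatrices\<close>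

text \<open>The Leibniz formula for the determinant of the principal submatrix on \<open>S\<close>.
  Indexing by a set means that deleting an index requires no renumbering.\<close>

definition minor :: "nat set \<Rightarrow> (nat \<Rightarrow> nat \<Rightarrow> 'a::comm_ring_1) \<Rightarrow> 'a" where
  "minor S M = (\<Sum>\<pi> | \<pi> permutes S. of_int (sign \<pi>) * (\<Prod>i\<in>S. M i (\<pi> i)))"

lemma permutes_fixing:
  "{\<pi>. \<pi> permutes S \<and> \<pi> i = i} = {\<pi>. \<pi> permutes (S - {i})}"
proof (intro equalityI subsetI)
  fix \<pi> assume "\<pi> \<in> {\<pi>. \<pi> permutes S \<and> \<pi> i = i}"
  then show "\<pi> \<in> {\<pi>. \<pi> permutes (S - {i})}" using permutes_superset[of \<pi> S "S - {i}"] by auto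
next
  fix \<pi> assume "\<pi> \<in> {\<pi>. \<pi> permutes (S - {i})}"
  then show "\<pi> \<in> {\<pi>. \<pi> permutes S \<and> \<pi> i = i}"
    using permutes_subset[of \<pi> "S - {i}" S] permutes_not_in[of \<pi> "S - {i}" i] by auto
qed

lemma minor_remove:
  assumes "finite S" "i \<in> S"
  shows "minor (S - {i}) M = (\<Sum>\<pi> | \<pi> permutes S \<and> \<pi> i = i. of_int (sign \<pi>) * (\<Prod>j\<in>S - {i}. M j (\<pi> j)))"
  unfolding minor_def permutes_fixing ..

text \<open>The determinant is affine in a diagonal entry: the permutations fixing \<open>i\<close>
  are those of \<open>S - {i}\<close> and produce the coefficient of \<open>w\<close>.\<close>

lemma minor_add_diag:
  assumes "finite S" "i \<in> S"
  shows "minor S (\<lambda>a b. M a b + (if a = i \<and> b = i then w else 0)) = minor S M + w * minor (S - {i}) M"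
proof -
  let ?M = "\<lambda>a b. M a b + (if a = i \<and> b = i then w else 0)"
  have prod: "(\<Prod>a\<in>S. ?M a (\<pi> a))
      = (\<Prod>a\<in>S. M a (\<pi> a)) + (if \<pi> i = i then w * (\<Prod>a\<in>S - {i}. M a (\<pi> a)) else 0)" for \<pi>
  proof -
    have "(\<Prod>a\<in>S. ?M a (\<pi> a)) = ?M i (\<pi> i) * (\<Prod>a\<in>S - {i}. ?M a (\<pi> a))"
      by (rule prod.remove) (use assms in auto)
    also have "(\<Prod>a\<in>S - {i}. ?M a (\<pi> a)) = (\<Prod>a\<in>S - {i}. M a (\<pi> a))"
      by (rule prod.cong) auto
    finally show ?thesis
      using prod.remove[OF assms, of "\<lambda>a. M a (\<pi> a)"] by (simp add: algebra_simps)
  qed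
  have "(\<Sum>\<pi> | \<pi> permutes S. if \<pi> i = i then of_int (sign \<pi>) * (w * (\<Prod>a\<in>S - {i}. M a (\<pi> a))) else 0)
     = (\<Sum>\<pi> | \<pi> permutes S \<and> \<pi> i = i. of_int (sign \<pi>) * (w * (\<Prod>a\<in>S - {i}. M a (\<pi> a))))"
    using finite_permutations[OF assms(1)]
    by (subst sum.inter_filter[symmetric]) (auto intro!: sum.cong)
  then show ?thesis
    unfolding minor_remove[OF assms] unfolding minor_def prod distrib_left sum.distrib sum_distrib_left
    by (simp add: if_distrib mult.left_commute cong: if_cong)
qed

definition charp :: "nat set \<Rightarrow> (nat \<Rightarrow> nat \<Rightarrow> 'a::comm_ring_1) \<Rightarrow> 'a poly" where
  "charp S B = minor S (\<lambda>i j. if i = j then [:- B i j, 1:] else [:- B i j:])"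

lemma poly_charp: "poly (charp S B) x = minor S (\<lambda>i j. (if i = j then x else 0) - B i j)"
  unfolding charp_def minor_def poly_sum
  by (intro sum.cong refl) (auto simp: poly_prod intro!: prod.cong arg_cong2[of _ _ _ _ "(*)"])

lemma complex_poly_charp: "complex_poly (charp S B) = charp S (\<lambda>i j. of_real (B i j))"
proof -
  have prod: "complex_poly (\<Prod>i\<in>I. f i) = (\<Prod>i\<in>I. complex_poly (f i))" for I :: "nat set" and f
    by (induction I rule: infinite_finite_induct) (simp_all add: complex_poly_mult)
  have int: "complex_poly (of_int n) = of_int n" for n
    by (rule poly_eqI) (simp add: coeff_map_poly of_int_poly coeff_pCons split: nat.splits)
  show ?thesis unfolding charp_def minor_def
    by (simp add: complex_poly_sum complex_poly_mult prod int)
       (intro sum.cong prod.cong arg_cong2[of _ _ _ _ "(*)"]; simp add: map_poly_pCons)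
qed

lemma pderiv_sum_set: "pderiv (\<Sum>i\<in>I. f i) = (\<Sum>i\<in>I. pderiv (f i))"
  by (induction I rule: infinite_finite_induct) (simp_all add: pderiv_add)

text \<open>In the product rule only diagonal factors have a nonzero derivative, so the term for
  \<open>i\<close> retains exactly the permutations fixing \<open>i\<close>. This identity turns
  sums over deletions into derivatives.\<close>

lemma pderiv_charp:
  fixes B :: "nat \<Rightarrow> nat \<Rightarrow> 'a::idom"
  assumes "finite S"
  shows "pderiv (charp S B) = (\<Sum>i\<in>S. charp (S - {i}) B)"
proof -
  let ?M = "\<lambda>i j. if i = j then [:- B i j, 1:] else [:- B i j:]"
  have int: "pderiv (of_int n * p) = of_int n * pderiv p" for n and p :: "'a poly"
    by (simp add: of_int_poly pderiv_smult)
  have "pderiv (charp S B) = (\<Sum>\<pi> | \<pi> permutes S. of_int (sign \<pi>) *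
      (\<Sum>i\<in>S. (\<Prod>j\<in>S - {i}. ?M j (\<pi> j)) * (if i = \<pi> i then 1 else 0)))"
    unfolding charp_def minor_def pderiv_sum_set int pderiv_prod
    by (intro sum.cong refl arg_cong2[of _ _ _ _ "(*)"]) (auto simp: pderiv_pCons)
  also have "\<dots> = (\<Sum>i\<in>S. \<Sum>\<pi> | \<pi> permutes S.
      if \<pi> i = i then of_int (sign \<pi>) * (\<Prod>j\<in>S - {i}. ?M j (\<pi> j)) else 0)"
    by (subst sum.swap) (auto simp: sum_distrib_left intro!: sum.cong)
  also have "\<dots> = (\<Sum>i\<in>S. charp (S - {i}) B)"
    unfolding charp_def using finite_permutations[OF assms] assms
    by (intro sum.cong refl) (auto simp: minor_remove sum.inter_filter[symmetric] intro!: sum.cong)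
  finally show ?thesis .
qed

lemma charp_empty: "charp {} B = 1"
  by (simp add: charp_def minor_def sign_id)

lemma charp_singleton: "charp {i} B = [:- B i i, 1:]"
  by (simp add: charp_def minor_def sign_id)

text \<open>Induction through \<open>pderiv_charp\<close>: the derivative determines every
  coefficient except the constant one. Only for a singleton is the trace coefficient constant, and
  that case is computed directly.\<close>

lemma coeff_charp:
  fixes B :: "nat \<Rightarrow> nat \<Rightarrow> real"
  assumes "finite S" "card S = n"
  shows "degree (charp S B) = n \<and> lead_coeff (charp S B) = 1 \<and>
    (n > 0 \<longrightarrow> coeff (charp S B) (n - 1) = - (\<Sum>i\<in>S. B i i))"
  using assms
proof (induction n arbitrary: S)
  case 0
  then show ?case by (simp add: charp_empty)
next
  case (Suc n)
  let ?p = "charp S B"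
  have IH: "degree (charp (S - {i}) B) = n \<and> lead_coeff (charp (S - {i}) B) = 1 \<and>
    (n > 0 \<longrightarrow> coeff (charp (S - {i}) B) (n - 1) = - (\<Sum>j\<in>S - {i}. B j j))" if "i \<in> S" for i
    using Suc that by (intro Suc.IH) auto
  have co: "of_nat (Suc j) * coeff ?p (Suc j) = (\<Sum>i\<in>S. coeff (charp (S - {i}) B) j)" for j
    using arg_cong[OF pderiv_charp[OF Suc.prems(1), of B], of "\<lambda>p. coeff p j"]
    by (simp only: coeff_pderiv coeff_sum)
  have "real (Suc n) * coeff ?p (Suc n) = real (card S)"
  proof -
    have "(\<Sum>i\<in>S. coeff (charp (S - {i}) B) n) = (\<Sum>i\<in>S. 1)"
      using IH by (intro sum.cong) force+
    then show ?thesis unfolding co by simp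
  qed
  then have top: "coeff ?p (Suc n) = 1" using Suc.prems(2) by simp
  have "coeff ?p j = 0" if j: "j > Suc n" for j
  proof -
    obtain l where l: "j = Suc l" "l > n" using j by (cases j) auto
    have "(\<Sum>i\<in>S. coeff (charp (S - {i}) B) l) = 0"
      using IH l by (intro sum.neutral) (auto simp: coeff_eq_0)
    then show ?thesis using co[of l] l by simp
  qed
  then have deg: "degree ?p = Suc n"
    using top by (intro antisym degree_le le_degree) auto
  have "coeff ?p n = - (\<Sum>i\<in>S. B i i)"
  proof (cases n)
    case 0
    then obtain i where "S = {i}" using Suc.prems card_1_singletonE by (metis One_nat_def)
    then show ?thesis using 0 by (simp add: charp_singleton)
  next
    case (Suc m)
    have "real n * coeff ?p n = (\<Sum>i\<in>S. coeff (charp (S - {i}) B) (n - 1))"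
      using co[of m] Suc by simp
    \<comment> \<open>There are \<open>n + 1\<close> summands, so the trace is subtracted
      \<open>n + 1\<close> times and added once.\<close>
    also have "\<dots> = (\<Sum>i\<in>S. B i i - (\<Sum>j\<in>S. B j j))"
      using IH Suc \<open>finite S\<close> by (intro sum.cong refl) (auto simp: sum_diff1)
    also have "\<dots> = - (real n * (\<Sum>i\<in>S. B i i))"
      using \<open>card S = Suc n\<close> by (simp add: sum_subtractf algebra_simps)
    finally have "real n * coeff ?p n = real n * - (\<Sum>i\<in>S. B i i)" by simp
    then show ?thesis using Suc by (metis mult_cancel_left of_nat_eq_0_iff old.nat.distinct(2))
  qed
  then show ?case using deg top by simp
qed

subsection \<open>Minors as determinants of padded matrices\<close>

text \<open>An identity block outside \<open>S\<close> preserves the determinant and gives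
  submatrices on different index sets a common size.\<close>

definition padded :: "nat \<Rightarrow> nat set \<Rightarrow> (nat \<Rightarrow> nat \<Rightarrow> 'a::comm_ring_1) \<Rightarrow> 'a mat" where
  "padded N S M = mat N N (\<lambda>(i, j). if i \<in> S \<and> j \<in> S then M i j else if i = j then 1 else 0)"

text \<open>A permutation that moves an index outside \<open>S\<close> meets a zero entry of the
  padding.\<close>

lemma minor_eq_det:
  assumes "S \<subseteq> {0..<N}"
  shows "minor S M = det (padded N S M)"
proof -
  let ?P = "\<lambda>i j. if i \<in> S \<and> j \<in> S then M i j else if i = j then 1 else 0"
  have fin: "finite S" using assms finite_subset by blast
  have "det (padded N S M) = (\<Sum>\<pi> | \<pi> permutes {0..<N}. of_int (sign \<pi>) * (\<Prod>i = 0..<N. ?P i (\<pi> i)))"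
    by (subst det_def'[of _ N]) (auto simp: padded_def permutes_in_image intro!: sum.cong prod.cong)
  also have "\<dots> = (\<Sum>\<pi> | \<pi> permutes S. of_int (sign \<pi>) * (\<Prod>i = 0..<N. ?P i (\<pi> i)))"
  proof (rule sum.mono_neutral_right)
    show "finite {\<pi>. \<pi> permutes {0..<N}}" by (simp add: finite_permutations)
    show "{\<pi>. \<pi> permutes S} \<subseteq> {\<pi>. \<pi> permutes {0..<N}}"
      using permutes_subset[OF _ assms] by auto
    show "\<forall>\<pi>\<in>{\<pi>. \<pi> permutes {0..<N}} - {\<pi>. \<pi> permutes S}.
        of_int (sign \<pi>) * (\<Prod>i = 0..<N. ?P i (\<pi> i)) = 0"
    proof
      fix \<pi> assume \<pi>: "\<pi> \<in> {\<pi>. \<pi> permutes {0..<N}} - {\<pi>. \<pi> permutes S}"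
      then obtain i where i: "i \<in> {0..<N}" "i \<notin> S" "\<pi> i \<noteq> i"
        using permutes_superset[of \<pi> "{0..<N}" S] by auto
      then have "(\<Prod>i = 0..<N. ?P i (\<pi> i)) = 0" by (intro prod_zero) (auto intro!: bexI[of _ i])
      then show "of_int (sign \<pi>) * (\<Prod>i = 0..<N. ?P i (\<pi> i)) = 0" by simp
    qed
  qed
  also have "\<dots> = minor S M" unfolding minor_def
  proof (intro sum.cong refl arg_cong2[of _ _ _ _ "(*)"])
    fix \<pi> assume \<pi>: "\<pi> \<in> {\<pi>. \<pi> permutes S}"
    have "(\<Prod>i = 0..<N. ?P i (\<pi> i)) = (\<Prod>i\<in>S. ?P i (\<pi> i))"
      using assms \<pi> by (intro prod.mono_neutral_right) (auto simp: permutes_def)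
    also have "\<dots> = (\<Prod>i\<in>S. M i (\<pi> i))"
      using \<pi> by (intro prod.cong) (auto simp: permutes_in_image)
    finally show "(\<Prod>i = 0..<N. ?P i (\<pi> i)) = (\<Prod>i\<in>S. M i (\<pi> i))" .
  qed
  finally show ?thesis by simp
qed

lemma finite_subset_upto: "finite S \<Longrightarrow> S \<subseteq> {0..<Suc (Max (insert 0 S))}" for S :: "nat set"
  by (auto simp: less_Suc_eq_le)

lemma padded_mult_vec:
  assumes "S \<subseteq> {0..<N}" "i < N" "v \<in> carrier_vec N"
  shows "(padded N S M *\<^sub>v v) $ i = (if i \<in> S then (\<Sum>j\<in>S. M i j * v $ j) else v $ i)"
proof -
  have "(padded N S M *\<^sub>v v) $ i
      = (\<Sum>j = 0..<N. (if i \<in> S \<and> j \<in> S then M i j else if i = j then 1 else 0) * v $ j)"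
    using assms by (simp add: padded_def scalar_prod_def)
  also have "\<dots> = (if i \<in> S then (\<Sum>j\<in>S. M i j * v $ j) else v $ i)"
  proof (cases "i \<in> S")
    case True
    have "(\<Sum>j = 0..<N. (if i \<in> S \<and> j \<in> S then M i j else if i = j then 1 else 0) * v $ j)
        = (\<Sum>j\<in>S. (if i \<in> S \<and> j \<in> S then M i j else if i = j then 1 else 0) * v $ j)"
      using assms True by (intro sum.mono_neutral_right) auto
    then show ?thesis using True by simp
  next
    case False
    have "(\<Sum>j = 0..<N. (if i \<in> S \<and> j \<in> S then M i j else if i = j then 1 else 0) * v $ j)
        = (\<Sum>j\<in>{i}. (if i \<in> S \<and> j \<in> S then M i j else if i = j then 1 else 0) * v $ j)"
      using assms False by (intro sum.mono_neutral_right) auto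
    then show ?thesis using False by simp
  qed
  finally show ?thesis .
qed

lemma minor_zero_kernel:
  fixes M :: "nat \<Rightarrow> nat \<Rightarrow> 'a::field"
  assumes "finite S" "minor S M = 0"
  shows "\<exists>v. (\<exists>i\<in>S. v i \<noteq> 0) \<and> (\<forall>i\<in>S. (\<Sum>j\<in>S. M i j * v j) = 0)"
proof -
  define N where "N = Suc (Max (insert 0 S))"
  have S: "S \<subseteq> {0..<N}" unfolding N_def using finite_subset_upto[OF assms(1)] .
  have "padded N S M \<in> carrier_mat N N" by (simp add: padded_def)
  then obtain v where v: "v \<in> carrier_vec N" "v \<noteq> 0\<^sub>v N" "padded N S M *\<^sub>v v = 0\<^sub>v N"
    using det_0_iff_vec_prod_zero_field assms(2) unfolding minor_eq_det[OF S] by blast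
  have eq: "(if i \<in> S then (\<Sum>j\<in>S. M i j * v $ j) else v $ i) = 0" if "i < N" for i
    using padded_mult_vec[OF S that v(1), of M] v(3) that by simp
  obtain i where i: "i < N" "v $ i \<noteq> 0" using v(1,2) by (metis carrier_vecD eq_vecI index_zero_vec)
  show ?thesis
  proof (intro exI[of _ "\<lambda>j. v $ j"] conjI ballI bexI[of _ i])
    show "i \<in> S" using eq[OF i(1)] i(2) by presburger
    show "(\<Sum>j\<in>S. M a j * v $ j) = 0" if "a \<in> S" for a using eq[of a] that S by auto
  qed fact
qed

lemma minor_nonzero_right_inverse:
  fixes M :: "nat \<Rightarrow> nat \<Rightarrow> 'a::field"
  assumes "finite S" "minor S M \<noteq> 0"
  obtains W where "\<And>v i. i \<in> S \<Longrightarrow> (\<Sum>j\<in>S. M i j * (\<Sum>l\<in>S. W j l * v l)) = v i"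
proof -
  define N where "N = Suc (Max (insert 0 S))"
  have S: "S \<subseteq> {0..<N}" unfolding N_def using finite_subset_upto[OF assms(1)] .
  have P: "padded N S M \<in> carrier_mat N N" by (simp add: padded_def)
  obtain W where W: "W \<in> carrier_mat N N" "padded N S M * W = 1\<^sub>m N"
    using det_non_zero_imp_unit[OF P, of "()"] assms(2) unfolding minor_eq_det[OF S]
    by (auto simp: Units_def ring_mat_def)
  have "(\<Sum>j\<in>S. M i j * (\<Sum>l\<in>S. W $$ (j, l) * v l)) = v i" if i: "i \<in> S" for v i
  proof -
    define x where "x = vec N (\<lambda>l. if l \<in> S then v l else 0)"
    have x: "x \<in> carrier_vec N" by (simp add: x_def)
    have "(W *\<^sub>v x) $ j = (\<Sum>l\<in>S. W $$ (j, l) * v l)" if "j \<in> S" for j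
    proof -
      have "(W *\<^sub>v x) $ j = (\<Sum>l = 0..<N. W $$ (j, l) * (if l \<in> S then v l else 0))"
        using W(1) S that by (auto simp: x_def scalar_prod_def intro!: sum.cong)
      also have "\<dots> = (\<Sum>l\<in>S. W $$ (j, l) * (if l \<in> S then v l else 0))"
        using S by (intro sum.mono_neutral_right) auto
      finally show ?thesis by simp
    qed
    then have "(\<Sum>j\<in>S. M i j * (\<Sum>l\<in>S. W $$ (j, l) * v l)) = (padded N S M *\<^sub>v (W *\<^sub>v x)) $ i"
      using padded_mult_vec[OF S, of i "W *\<^sub>v x" M] W x S i by auto
    also have "padded N S M *\<^sub>v (W *\<^sub>v x) = x"
      using assoc_mult_mat_vec[OF P W(1) x] W(2) x by simp
    finally show ?thesis using i S by (auto simp: x_def)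
  qed
  then show ?thesis by (rule that)
qed

text \<open>A kernel vector \<open>v\<close> of \<open>z I - B + w e\<^sub>i e\<^sub>i\<^sup>T\<close> satisfies \<open>Im z |v|\<^sup>2 + Im w |v\<^sub>i|\<^sup>2 = 0\<close>.\<close>

lemma minor_symmetric_nonzero:
  fixes B :: "nat \<Rightarrow> nat \<Rightarrow> real" and z w :: complex
  assumes "finite S" and sym: "\<And>i j. B i j = B j i" and z: "Im z > 0" and w: "Im w \<ge> 0"
  shows "minor S (\<lambda>a b. ((if a = b then z else 0) - of_real (B a b)) + (if a = i \<and> b = i then w else 0)) \<noteq> 0"
proof
  let ?M = "\<lambda>a b. ((if a = b then z else 0) - of_real (B a b)) + (if a = i \<and> b = i then w else 0)"
  assume "minor S ?M = 0"
  from minor_zero_kernel[OF assms(1) this]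
  obtain v k where k: "k \<in> S" "v k \<noteq> 0" and v: "\<And>a. a \<in> S \<Longrightarrow> (\<Sum>b\<in>S. ?M a b * v b) = 0"
    by blast
  \<comment> \<open>The quadratic form of a real symmetric matrix takes real values, so it drops out
    of the imaginary part.\<close>
  let ?Q = "\<Sum>a\<in>S. \<Sum>b\<in>S. cnj (v a) * of_real (B a b) * v b"
  have "cnj ?Q = (\<Sum>a\<in>S. \<Sum>b\<in>S. v a * of_real (B a b) * cnj (v b))" by simp
  also have "\<dots> = (\<Sum>b\<in>S. \<Sum>a\<in>S. v a * of_real (B a b) * cnj (v b))" by (rule sum.swap)
  also have "\<dots> = ?Q" by (intro sum.cong refl) (simp add: sym mult_ac)
  finally have "cnj ?Q = ?Q" .
  moreover have "cnj c = c \<Longrightarrow> Im c = 0" for c by (simp add: complex_eq_iff)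
  ultimately have Q: "Im ?Q = 0" by blast
  have "0 = (\<Sum>a\<in>S. cnj (v a) * (\<Sum>b\<in>S. ?M a b * v b))" using v by simp
  also have "\<dots> = (\<Sum>a\<in>S. \<Sum>b\<in>S. (if a = b then z * (cnj (v a) * v a) else 0)
      - cnj (v a) * of_real (B a b) * v b + (if a = i \<and> b = i then w * (cnj (v i) * v i) else 0))"
    by (auto simp: sum_distrib_left algebra_simps intro!: sum.cong)
  also have "\<dots> = z * (\<Sum>a\<in>S. cnj (v a) * v a) - ?Q
      + (\<Sum>a\<in>S. if a = i then w * (cnj (v i) * v i) else 0)"
  proof -
    have "(\<Sum>a\<in>S. \<Sum>b\<in>S. if a = b then z * (cnj (v a) * v a) else 0) = z * (\<Sum>a\<in>S. cnj (v a) * v a)"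
      using assms(1) by (simp add: sum_distrib_left)
    moreover have "(\<Sum>a\<in>S. \<Sum>b\<in>S. if a = i \<and> b = i then w * (cnj (v i) * v i) else 0)
        = (\<Sum>a\<in>S. if a = i then w * (cnj (v i) * v i) else 0)"
      by (intro sum.cong refl) (use assms(1) in auto)
    ultimately show ?thesis by (simp only: sum.distrib sum_subtractf)
  qed
  finally have eq: "0 = z * (\<Sum>a\<in>S. cnj (v a) * v a) - ?Q
      + (\<Sum>a\<in>S. if a = i then w * (cnj (v i) * v i) else 0)" .
  have sq: "cnj c * c = of_real ((cmod c)\<^sup>2)" for c
    by (metis complex_norm_square mult.commute)
  have "0 = Im (z * of_real (\<Sum>a\<in>S. (cmod (v a))\<^sup>2)) - Im ?Q
      + (\<Sum>a\<in>S. Im (if a = i then w * of_real ((cmod (v i))\<^sup>2) else 0))"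
    using arg_cong[OF eq, of Im] by (simp only: sq Im_sum plus_complex.sel minus_complex.sel of_real_sum zero_complex.sel)
  then have "0 = Im z * (\<Sum>a\<in>S. (cmod (v a))\<^sup>2) + (\<Sum>a\<in>S. if a = i then Im w * (cmod (v i))\<^sup>2 else 0)"
    unfolding Q by (simp only: times_complex.sel Re_complex_of_real Im_complex_of_real if_distrib[of Im] zero_complex.sel
      mult_zero_right add_0_left diff_0_right)
  moreover have "(\<Sum>a\<in>S. (cmod (v a))\<^sup>2) > 0"
    using k assms(1) by (intro sum_pos2[of _ k]) auto
  then have "Im z * (\<Sum>a\<in>S. (cmod (v a))\<^sup>2) > 0" using z by simp
  moreover have "(\<Sum>a\<in>S. if a = i then Im w * (cmod (v i))\<^sup>2 else 0) \<ge> 0"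
    using w by (intro sum_nonneg) auto
  ultimately show False by linarith
qed

lemma hp_stable_charp:
  assumes "finite S" "\<And>i j. B i j = B j i"
  shows "hp_stable (complex_poly (charp S B))"
  using minor_symmetric_nonzero[OF assms, where w = 0 and i = 0]
  by (simp add: hp_stable_def complex_poly_charp poly_charp)

text \<open>By \<open>minor_add_diag\<close>, \<open>h + w q\<close> evaluates to the determinant of
  \<open>z I - B\<close> with \<open>w\<close> added at the diagonal entry \<open>i\<close>, which
  is nonzero in the upper half-plane.\<close>

lemma interlaces_charp:
  assumes "finite S" "\<And>i j. B i j = B j i" "i \<in> S"
  shows "interlaces (charp (S - {i}) B) (charp S B)"
  unfolding interlaces_iff
proof (intro conjI allI impI)
  show "hp_stable (complex_poly (charp S B))" using hp_stable_charp assms by blast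
  fix w :: complex assume w: "Im w > 0"
  show "hp_stable (complex_poly (charp S B) + Polynomial.smult w (complex_poly (charp (S - {i}) B)))"
    unfolding hp_stable_def
  proof (intro allI impI)
    fix z :: complex assume "Im z > 0"
    then show "poly (complex_poly (charp S B) + Polynomial.smult w (complex_poly (charp (S - {i}) B))) z \<noteq> 0"
      using minor_symmetric_nonzero[OF assms(1,2), where z = z and w = w and i = i] w
      unfolding minor_add_diag[OF assms(1,3)]
      by (simp add: complex_poly_charp poly_charp)
  qed
qed

lemma pos_real_rooted_charp:
  assumes "finite S" "\<And>i j. B i j = B j i"
  shows "pos_real_rooted (card S) (charp S B)"
  using coeff_charp[OF assms(1) refl, of B] hp_stable_charp[of S B] assms by (auto simp: pos_real_rooted_def)

section \<open>Selecting a principal submatrix\<close>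

lemma pderiv_funpow_sum: "(pderiv ^^ n) (\<Sum>i\<in>I. f i) = (\<Sum>i\<in>I. (pderiv ^^ n) (f i))"
  by (induction n) (simp_all add: pderiv_sum_set)

lemma interlaces_pderiv_funpow:
  assumes "interlaces q h" "pos_real_rooted (k + n) q" "pos_real_rooted (Suc k + n) h"
  shows "interlaces ((pderiv ^^ n) q) ((pderiv ^^ n) h)"
  using assms
proof (induction n arbitrary: k)
  case (Suc n)
  have "interlaces ((pderiv ^^ n) q) ((pderiv ^^ n) h)"
    using Suc.prems by (intro Suc.IH[of "Suc k"]) auto
  moreover have "degree ((pderiv ^^ n) q) < degree ((pderiv ^^ n) h)"
  proof -
    have "pos_real_rooted (Suc k) ((pderiv ^^ n) q)" "pos_real_rooted (Suc (Suc k)) ((pderiv ^^ n) h)"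
      using Suc.prems(2,3) by (auto intro!: pos_real_rooted_pderiv_funpow)
    then show ?thesis by (simp add: pos_real_rooted_def)
  qed
  ultimately show ?case by (simp add: interlaces_pderiv)
qed simp

text \<open>Interlacing family: the polynomials attached to \<open>S - {i}\<close> sum up to the one attached to \<open>S\<close>, and
  they have a common interlacing polynomial, so one of them inherits the bound on the zeros.\<close>

lemma exists_principal_submatrix:
  fixes B :: "nat \<Rightarrow> nat \<Rightarrow> real"
  assumes sym: "\<And>i j. B i j = B j i" and "finite S" "card S = k + m"
    and "\<And>x. x \<ge> t \<Longrightarrow> poly ((pderiv ^^ n) (monom 1 n * (pderiv ^^ m) (charp S B))) x > 0"
  shows "\<exists>S'\<subseteq>S. card S' = k \<and> (\<forall>x\<ge>t. poly ((pderiv ^^ n) (monom 1 n * charp S' B)) x > 0)"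
  using assms(2-)
proof (induction m arbitrary: S)
  case 0
  then show ?case by (intro exI[of _ S]) auto
next
  case (Suc m)
  \<comment> \<open>The linear operator still pending after one deletion; one of the
    \<open>Suc m\<close> inner derivatives is spent on summing over the deleted index.\<close>
  define L where "L = (\<lambda>p :: real poly. (pderiv ^^ n) (monom 1 n * (pderiv ^^ m) p))"
  have L_good: "pos_real_rooted j (L p)" if "pos_real_rooted (j + m) p" for j p
  proof -
    have "pos_real_rooted (j + n) (monom 1 n * (pderiv ^^ m) p)"
      using pos_real_rooted_monom_mult[OF pos_real_rooted_pderiv_funpow[OF that], of n] by (simp add: add.commute)
    then show ?thesis unfolding L_def by (rule pos_real_rooted_pderiv_funpow)
  qed
  have g: "pos_real_rooted (k + m) (charp (S - {i}) B)" if "i \<in> S" for i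
    using pos_real_rooted_charp[of "S - {i}" B] sym Suc.prems(1,2) that by simp
  have gS: "pos_real_rooted (Suc k + m) (charp S B)"
    using pos_real_rooted_charp[of S B] sym Suc.prems(1,2) by simp
  have L_int: "interlaces (L (charp (S - {i}) B)) (L (charp S B))" if "i \<in> S" for i
  proof -
    have "interlaces ((pderiv ^^ m) (charp (S - {i}) B)) ((pderiv ^^ m) (charp S B))"
      by (rule interlaces_pderiv_funpow[OF interlaces_charp[OF Suc.prems(1) sym that] g[OF that] gS])
    then have "interlaces (monom 1 n * (pderiv ^^ m) (charp (S - {i}) B)) (monom 1 n * (pderiv ^^ m) (charp S B))"
      by (rule interlaces_monom_mult)
    moreover have "pos_real_rooted (k + n) (monom 1 n * (pderiv ^^ m) (charp (S - {i}) B))"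
      using pos_real_rooted_monom_mult[OF pos_real_rooted_pderiv_funpow[OF g[OF that]], of n] by (simp add: add.commute)
    moreover have "pos_real_rooted (Suc k + n) (monom 1 n * (pderiv ^^ m) (charp S B))"
      using pos_real_rooted_monom_mult[OF pos_real_rooted_pderiv_funpow[OF gS], of n] by (simp add: add.commute)
    ultimately show ?thesis unfolding L_def by (rule interlaces_pderiv_funpow)
  qed
  define F where "F = (\<Sum>i\<in>S. L (charp (S - {i}) B))"
  have "(pderiv ^^ n) (monom 1 n * (pderiv ^^ Suc m) (charp S B)) = F"
    by (simp add: F_def L_def funpow_swap1 pderiv_charp[OF Suc.prems(1)] pderiv_funpow_sum sum_distrib_left)
  then have F: "poly F x > 0" if "x \<ge> t" for x using Suc.prems(3)[OF that] by simp
  have F_int: "interlaces F (L (charp S B))"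
    unfolding F_def using L_good[OF gS] by (intro interlaces_sum L_int) (auto simp: pos_real_rooted_def)
  \<comment> \<open>The sum is positive at \<open>t\<close>, so some summand is positive there; the
    common interlacing then extends positivity to all larger points.\<close>
  obtain i where i: "i \<in> S" "poly (L (charp (S - {i}) B)) t > 0"
    using F[of t] sum_nonpos[of S "\<lambda>i. poly (L (charp (S - {i}) B)) t"]
    by (force simp: F_def poly_sum not_le)
  have "poly (L (charp (S - {i}) B)) x > 0" if "x \<ge> t" for x
    using interlaces_pos_propagate[OF F_int L_int[OF i(1)] _ _ F i(2) that] L_good[OF gS] L_good[OF g[OF i(1)]]
    by (auto simp: pos_real_rooted_def)
  then obtain S' where "S' \<subseteq> S - {i}" "card S' = k"
      "\<forall>x\<ge>t. poly ((pderiv ^^ n) (monom 1 n * charp S' B)) x > 0"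
    using Suc.IH[of "S - {i}"] Suc.prems(1,2) i(1) unfolding L_def by force
  then show ?case by blast
qed

section \<open>Gram matrices\<close>

text \<open>The summation set fixes one side of the submatrix and the principal submatrix cuts out
  the other: on \<open>S\<close> this is the product of the submatrix with rows \<open>S\<close> and
  columns \<open>R\<close> and its transpose.\<close>

definition row_gram :: "nat set \<Rightarrow> (nat \<Rightarrow> nat \<Rightarrow> real) \<Rightarrow> nat \<Rightarrow> nat \<Rightarrow> real" where
  "row_gram R A i j = (\<Sum>l\<in>R. A i l * A j l)"

definition col_gram :: "nat set \<Rightarrow> (nat \<Rightarrow> nat \<Rightarrow> real) \<Rightarrow> nat \<Rightarrow> nat \<Rightarrow> real" where
  "col_gram S A i j = (\<Sum>l\<in>S. A l i * A l j)"

lemma row_gram_sym: "row_gram R A i j = row_gram R A j i"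
  by (simp add: row_gram_def mult.commute)

lemma col_gram_sym: "col_gram S A i j = col_gram S A j i"
  by (simp add: col_gram_def mult.commute)

lemma det_diagonal_indicator:
  fixes x :: "'a::comm_ring_1"
  assumes "S \<subseteq> {0..<N}"
  shows "det (mat N N (\<lambda>(i, j). if i = j then if i \<in> S then x else 1 else 0)) = x ^ card S"
proof -
  let ?D = "mat N N (\<lambda>(i, j). if i = j then if i \<in> S then x else 1 else 0)"
  have "det ?D = prod_list (diag_mat ?D)"
    by (rule det_upper_triangular[of _ N]) auto
  also have "\<dots> = (\<Prod>i = 0..<N. if i \<in> S then x else 1)"
    unfolding prod_list_diag_prod by (auto intro!: prod.cong)
  also have "\<dots> = (\<Prod>i\<in>S. x)"
    using assms by (intro prod.mono_neutral_cong_right) auto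
  finally show ?thesis by simp
qed

text \<open>Sylvester's identity, from two block triangular factorizations of \<open>[[x I, A], [A\<^sup>T, I]]\<close>.\<close>

lemma minor_gram_commute:
  assumes "finite S" "finite R"
  shows "x ^ card R * minor S (\<lambda>i j. (if i = j then x else 0) - row_gram R A i j)
       = x ^ card S * minor R (\<lambda>i j. (if i = j then x else 0) - col_gram S A i j)"
proof -
  define N where "N = Suc (Max (insert 0 (S \<union> R)))"
  have "S \<union> R \<subseteq> {0..<N}" unfolding N_def using assms by (intro finite_subset_upto) auto
  then have S: "S \<subseteq> {0..<N}" and R: "R \<subseteq> {0..<N}" by auto
  define D where "D = (\<lambda>T. mat N N (\<lambda>(i, j). if i = j then if i \<in> T then x else 1 else (0::real)))"
  define P where "P = mat N N (\<lambda>(i, j). if i \<in> S \<and> j \<in> R then A i j else 0)"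
  define Q where "Q = mat N N (\<lambda>(i, j). if i \<in> R \<and> j \<in> S then A j i else 0)"
  define I where "I = (1\<^sub>m N :: real mat)"
  define Z where "Z = (0\<^sub>m N N :: real mat)"
  have c: "D T \<in> carrier_mat N N" "P \<in> carrier_mat N N" "Q \<in> carrier_mat N N" "I \<in> carrier_mat N N"
      "Z \<in> carrier_mat N N" for T
    by (auto simp: D_def P_def Q_def I_def Z_def)
  have [simp]: "dim_row (D T) = N" "dim_col (D T) = N" for T by (auto simp: D_def)
  have PQ: "padded N S (\<lambda>i j. (if i = j then x else 0) - row_gram R A i j) = D S - P * Q"
  proof (rule eq_matI)
    fix i j assume "i < dim_row (D S - P * Q)" "j < dim_col (D S - P * Q)"
    then have ij: "i < N" "j < N" using c by auto
    have "(P * Q) $$ (i, j) = (\<Sum>l = 0..<N. (if i \<in> S \<and> l \<in> R then A i l else 0) * (if l \<in> R \<and> j \<in> S then A j l else 0))"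
      using ij by (simp add: P_def Q_def scalar_prod_def)
    also have "\<dots> = (if i \<in> S \<and> j \<in> S then row_gram R A i j else 0)"
    proof (cases "i \<in> S \<and> j \<in> S")
      case True
      then show ?thesis unfolding row_gram_def using R
        by (auto intro!: sum.mono_neutral_cong_right)
    qed (auto intro!: sum.neutral)
    finally show "padded N S (\<lambda>i j. (if i = j then x else 0) - row_gram R A i j) $$ (i, j) = (D S - P * Q) $$ (i, j)"
      using ij c by (auto simp: padded_def D_def)
  qed (use c in \<open>auto simp: padded_def\<close>)
  have QP: "padded N R (\<lambda>i j. (if i = j then x else 0) - col_gram S A i j) = D R - Q * P"
  proof (rule eq_matI)
    fix i j assume "i < dim_row (D R - Q * P)" "j < dim_col (D R - Q * P)"
    then have ij: "i < N" "j < N" using c by auto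
    have "(Q * P) $$ (i, j) = (\<Sum>l = 0..<N. (if i \<in> R \<and> l \<in> S then A l i else 0) * (if l \<in> S \<and> j \<in> R then A l j else 0))"
      using ij by (simp add: P_def Q_def scalar_prod_def)
    also have "\<dots> = (if i \<in> R \<and> j \<in> R then col_gram S A i j else 0)"
    proof (cases "i \<in> R \<and> j \<in> R")
      case True
      then show ?thesis unfolding col_gram_def using S
        by (auto intro!: sum.mono_neutral_cong_right)
    qed (auto intro!: sum.neutral)
    finally show "padded N R (\<lambda>i j. (if i = j then x else 0) - col_gram S A i j) $$ (i, j) = (D R - Q * P) $$ (i, j)"
      using ij c by (auto simp: padded_def D_def)
  qed (use c in \<open>auto simp: padded_def\<close>)
  \<comment> \<open>\<open>Q\<close> is supported on rows in \<open>R\<close> and columns in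
    \<open>S\<close>, where both diagonal matrices act as the scalar \<open>x\<close>. Hence the
    lower left block of the second factorization cancels.\<close>
  have QD: "Q * D S = x \<cdot>\<^sub>m Q"
  proof (rule eq_matI)
    fix i j assume "i < dim_row (x \<cdot>\<^sub>m Q)" "j < dim_col (x \<cdot>\<^sub>m Q)"
    then have ij: "i < N" "j < N" using c by auto
    have "(Q * D S) $$ (i, j) = (\<Sum>l = 0..<N. Q $$ (i, l) * (if l = j then if l \<in> S then x else 1 else 0))"
      using ij c by (auto simp: scalar_prod_def D_def)
    also have "\<dots> = (\<Sum>l\<in>{j}. Q $$ (i, l) * (if l = j then if l \<in> S then x else 1 else 0))"
      using ij by (intro sum.mono_neutral_right) auto
    finally show "(Q * D S) $$ (i, j) = (x \<cdot>\<^sub>m Q) $$ (i, j)"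
      using ij c by (auto simp: Q_def)
  qed (use c in auto)
  have DQ: "D R * Q = x \<cdot>\<^sub>m Q"
  proof (rule eq_matI)
    fix i j assume "i < dim_row (x \<cdot>\<^sub>m Q)" "j < dim_col (x \<cdot>\<^sub>m Q)"
    then have ij: "i < N" "j < N" using c by auto
    have "(D R * Q) $$ (i, j) = (\<Sum>l = 0..<N. (if i = l then if i \<in> R then x else 1 else 0) * Q $$ (l, j))"
      using ij c by (auto simp: scalar_prod_def D_def)
    also have "\<dots> = (\<Sum>l\<in>{i}. (if i = l then if i \<in> R then x else 1 else 0) * Q $$ (l, j))"
      using ij by (intro sum.mono_neutral_right) auto
    finally show "(D R * Q) $$ (i, j) = (x \<cdot>\<^sub>m Q) $$ (i, j)"
      using ij c by (auto simp: Q_def)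
  qed (use c in auto)
  let ?K = "four_block_mat (D S) P Q I"
  have K: "?K \<in> carrier_mat (N + N) (N + N)" using c by (intro four_block_carrier_mat) auto
  have mQ: "- Q \<in> carrier_mat N N" using c by auto
  have mul: "P * Q \<in> carrier_mat N N" "Q * P \<in> carrier_mat N N" using c by auto
  have "?K * four_block_mat I Z (- Q) I = four_block_mat (D S - P * Q) P Z I"
  proof -
    have "P * (- Q) = - (P * Q)" using c by (intro uminus_mult_right_mat) auto
    then have "D S * I + P * (- Q) = D S - P * Q"
      using c mul unfolding I_def right_mult_one_mat[OF c(1)] by (simp add: add_uminus_minus_mat[OF c(1) mul(1)])
    moreover have "D S * Z + P * I = P"
      unfolding I_def Z_def right_mult_one_mat[OF c(2)] right_mult_zero_mat[OF c(1)] using c by simp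
    moreover have "Q * I + I * (- Q) = Z"
      unfolding I_def Z_def right_mult_one_mat[OF c(3)] left_mult_one_mat[OF mQ] using c by auto
    moreover have "Q * Z + I * I = I"
      unfolding Z_def right_mult_zero_mat[OF c(3)] by (simp add: I_def)
    ultimately show ?thesis
      by (simp add: mult_four_block_mat[OF c(1,2,3,4) c(4,5) mQ c(4)])
  qed
  then have "det ?K * det (four_block_mat I Z (- Q) I) = det (four_block_mat (D S - P * Q) P Z I)"
    using det_mult[OF K four_block_carrier_mat[OF c(4) c(4), of Z "- Q"]] by simp
  moreover have "det (four_block_mat I Z (- Q) I) = 1"
    by (subst det_four_block_mat_upper_right_zero[of _ N _ N]) (use c mQ in \<open>auto simp: I_def Z_def\<close>)
  moreover have "det (four_block_mat (D S - P * Q) P Z I) = det (D S - P * Q)"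
    by (subst det_four_block_mat_lower_left_zero[of _ N _ N]) (use c in \<open>auto simp: I_def Z_def\<close>)
  ultimately have K1: "det ?K = det (D S - P * Q)" by simp
  have "four_block_mat I Z (- Q) (D R) * ?K = four_block_mat (D S) P Z (D R - Q * P)"
  proof -
    have "I * D S + Z * Q = D S" "I * P + Z * I = P"
      unfolding Z_def left_mult_zero_mat[OF c(3)] left_mult_zero_mat[OF c(4)]
      unfolding I_def left_mult_one_mat[OF c(1)] left_mult_one_mat[OF c(2)]
      by (rule right_add_zero_mat[OF c(1)] right_add_zero_mat[OF c(2)])+
    moreover have "- Q * D S + D R * Q = Z"
    proof -
      have "- Q * D S = - (Q * D S)" by (rule uminus_mult_left_mat) (simp add: Q_def D_def)
      then show ?thesis unfolding DQ QD using c by (simp add: Z_def)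
    qed
    moreover have "- Q * P + D R * I = D R - Q * P"
    proof -
      have "- Q * P = - (Q * P)" using c by (intro uminus_mult_left_mat) auto
      then show ?thesis
        unfolding I_def right_mult_one_mat[OF c(1)]
        using comm_add_mat[OF uminus_carrier_mat[OF mul(2)] c(1)[of R]] add_uminus_minus_mat[OF c(1) mul(2)] by simp
    qed
    ultimately show ?thesis
      by (simp add: mult_four_block_mat[OF c(4,5) mQ c(1) c(1,2,3,4)])
  qed
  then have "det (four_block_mat I Z (- Q) (D R)) * det ?K = det (four_block_mat (D S) P Z (D R - Q * P))"
    using det_mult[OF four_block_carrier_mat[OF c(4) c(1)[of R], of Z "- Q"] K] by simp
  moreover have "det (four_block_mat I Z (- Q) (D R)) = det (D R)"
    by (subst det_four_block_mat_upper_right_zero[of _ N _ N]) (use c mQ in \<open>auto simp: I_def Z_def\<close>)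
  moreover have "det (four_block_mat (D S) P Z (D R - Q * P)) = det (D S) * det (D R - Q * P)"
    by (rule det_four_block_mat_lower_left_zero[of _ N _ N]) (use c in \<open>auto simp: I_def Z_def\<close>)
  ultimately have "det (D R) * det (D S - P * Q) = det (D S) * det (D R - Q * P)"
    using K1 by simp
  moreover have "det (D S) = x ^ card S" "det (D R) = x ^ card R"
    unfolding D_def by (intro det_diagonal_indicator S R)+
  ultimately show ?thesis
    unfolding minor_eq_det[OF S] minor_eq_det[OF R] PQ QP by simp
qed

text \<open>A power of the variable is cancelled in Sylvester's identity; the remaining factor
  accounts for the \<open>n\<close> additional zero eigenvalues.\<close>

lemma charp_gram:
  assumes "finite S" "finite R" "card R = card S + n"
  shows "charp R (col_gram S A) = monom 1 n * charp S (row_gram R A)"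
proof -
  have "monom 1 (card S) * charp R (col_gram S A) = monom 1 (card R) * charp S (row_gram R A)"
    unfolding poly_eq_poly_eq_iff[symmetric]
    using minor_gram_commute[OF assms(1,2), of _ A] by (auto simp: poly_monom poly_charp)
  also have "monom 1 (card R) = (monom 1 (card S) * monom 1 n :: real poly)"
    by (simp add: assms(3) mult_monom)
  finally show ?thesis
    unfolding mult.assoc by simp
qed

section \<open>The spectral norm\<close>

definition nsq :: "nat set \<Rightarrow> (nat \<Rightarrow> real) \<Rightarrow> real" where
  "nsq R v = (\<Sum>j\<in>R. (v j)\<^sup>2)"

definition mat_app :: "nat set \<Rightarrow> (nat \<Rightarrow> nat \<Rightarrow> real) \<Rightarrow> (nat \<Rightarrow> real) \<Rightarrow> nat \<Rightarrow> real" where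
  "mat_app R M v i = (\<Sum>j\<in>R. M i j * v j)"

lemma nsq_nonneg: "nsq R v \<ge> 0"
  by (simp add: nsq_def sum_nonneg)

lemma nsq_eq_0_iff: "finite R \<Longrightarrow> nsq R v = 0 \<longleftrightarrow> (\<forall>j\<in>R. v j = 0)"
  by (simp add: nsq_def sum_nonneg_eq_0_iff)

lemma spec_norm_alt:
  "spec_norm S R M = (SUP x\<in>{x. (\<forall>j. j \<notin> R \<longrightarrow> x j = 0) \<and> nsq R x \<le> 1}. sqrt (nsq S (mat_app R M x)))"
  by (simp add: spec_norm_def nsq_def mat_app_def)

lemma spec_norm_le:
  assumes "c \<ge> 0" "\<And>v. nsq S (mat_app R M v) \<le> c\<^sup>2 * nsq R v"
  shows "spec_norm S R M \<le> c"
  unfolding spec_norm_alt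
proof (rule cSUP_least)
  show "{x. (\<forall>j. j \<notin> R \<longrightarrow> x j = 0) \<and> nsq R x \<le> 1} \<noteq> {}"
    by (auto intro!: exI[of _ "\<lambda>_. 0"] simp: nsq_def)
  fix x assume "x \<in> {x. (\<forall>j. j \<notin> R \<longrightarrow> x j = 0) \<and> nsq R x \<le> 1}"
  then have "c\<^sup>2 * nsq R x \<le> c\<^sup>2 * 1" by (intro mult_left_mono) auto
  then show "sqrt (nsq S (mat_app R M x)) \<le> c"
    using assms(2)[of x] assms(1) by (intro real_le_lsqrt) (auto simp: nsq_nonneg)
qed

text \<open>The real supremum is an upper bound only for bounded sets; a crude entrywise estimate
  provides boundedness.\<close>

lemma bdd_above_spec_norm:
  assumes "finite R"
  shows "bdd_above ((\<lambda>x. sqrt (nsq S (mat_app R M x))) ` {x. (\<forall>j. j \<notin> R \<longrightarrow> x j = 0) \<and> nsq R x \<le> 1})"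
proof (rule bdd_aboveI2)
  fix x assume "x \<in> {x. (\<forall>j. j \<notin> R \<longrightarrow> x j = 0) \<and> nsq R x \<le> 1}"
  then have x: "nsq R x \<le> 1" by simp
  have "\<bar>x j\<bar> \<le> 1" if "j \<in> R" for j
  proof -
    have "(x j)\<^sup>2 \<le> nsq R x" unfolding nsq_def using assms that by (intro member_le_sum) auto
    then show ?thesis using x by (simp flip: abs_square_le_1)
  qed
  then have "\<bar>mat_app R M x i\<bar> \<le> (\<Sum>j\<in>R. \<bar>M i j\<bar>)" for i
    unfolding mat_app_def by (intro order_trans[OF sum_abs] sum_mono) (auto simp: abs_mult intro!: mult_left_le)
  then have "(mat_app R M x i)\<^sup>2 \<le> (\<Sum>j\<in>R. \<bar>M i j\<bar>)\<^sup>2" for i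
    by (metis abs_ge_zero power2_abs power_mono)
  then show "sqrt (nsq S (mat_app R M x)) \<le> sqrt (\<Sum>i\<in>S. (\<Sum>j\<in>R. \<bar>M i j\<bar>)\<^sup>2)"
    unfolding nsq_def by (intro real_sqrt_le_mono sum_mono)
qed

lemma spec_norm_nonneg:
  assumes "finite R"
  shows "spec_norm S R M \<ge> 0"
proof -
  have "sqrt (nsq S (mat_app R M (\<lambda>_. 0))) \<le> spec_norm S R M"
    unfolding spec_norm_alt by (rule cSUP_upper[OF _ bdd_above_spec_norm[OF assms]]) (simp add: nsq_def)
  then show ?thesis by (simp add: mat_app_def nsq_def)
qed

lemma spec_norm_bound:
  assumes "finite R"
  shows "nsq S (mat_app R M v) \<le> (spec_norm S R M)\<^sup>2 * nsq R v"
proof (cases "nsq R v = 0")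
  case True
  then have "mat_app R M v i = 0" for i
    using assms by (simp add: nsq_eq_0_iff mat_app_def)
  then show ?thesis using True by (simp add: nsq_def)
next
  case False
  define a where "a = sqrt (nsq R v)"
  have a: "a > 0" "a\<^sup>2 = nsq R v" using False nsq_nonneg[of R v] by (auto simp: a_def)
  define x where "x = (\<lambda>j. if j \<in> R then v j / a else 0)"
  have "nsq R x = nsq R v / a\<^sup>2"
    by (simp add: nsq_def x_def power_divide sum_divide_distrib)
  then have "nsq R x \<le> 1" using a False by simp
  then have "sqrt (nsq S (mat_app R M x)) \<le> spec_norm S R M"
    unfolding spec_norm_alt by (intro cSUP_upper[OF _ bdd_above_spec_norm[OF assms]]) (simp add: x_def)
  then have "nsq S (mat_app R M x) \<le> (spec_norm S R M)\<^sup>2"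
    by (metis nsq_nonneg real_sqrt_ge_zero real_sqrt_pow2 power_mono)
  moreover have "mat_app R M x i = mat_app R M v i / a" for i
    by (simp add: mat_app_def x_def sum_divide_distrib)
  then have "nsq S (mat_app R M x) = nsq S (mat_app R M v) / a\<^sup>2"
    by (simp add: nsq_def power_divide sum_divide_distrib)
  ultimately have "nsq S (mat_app R M v) / a\<^sup>2 \<le> (spec_norm S R M)\<^sup>2" by simp
  then show ?thesis using a by (metis pos_divide_le_eq zero_less_power)
qed

lemma nsq_mat_app:
  "nsq S (mat_app R M v) = (\<Sum>i\<in>R. v i * mat_app R (col_gram S M) v i)"
proof -
  have "nsq S (mat_app R M v) = (\<Sum>l\<in>S. \<Sum>i\<in>R. \<Sum>j\<in>R. v i * (M l i * M l j * v j))"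
    unfolding nsq_def mat_app_def power2_eq_square sum_product by (intro sum.cong refl) (simp add: mult_ac)
  also have "\<dots> = (\<Sum>i\<in>R. \<Sum>l\<in>S. \<Sum>j\<in>R. v i * (M l i * M l j * v j))"
    by (rule sum.swap)
  also have "\<dots> = (\<Sum>i\<in>R. v i * mat_app R (col_gram S M) v i)"
  proof (rule sum.cong[OF refl])
    fix i
    show "(\<Sum>l\<in>S. \<Sum>j\<in>R. v i * (M l i * M l j * v j)) = v i * mat_app R (col_gram S M) v i"
      unfolding mat_app_def col_gram_def sum_distrib_left sum_distrib_right by (rule sum.swap)
  qed
  finally show ?thesis .
qed

text \<open>If \<open>s\<close> is the norm, the form \<open>s\<^sup>2 |v|\<^sup>2 - |M v|\<^sup>2\<close> is nonnegative with infimum \<open>0\<close> on the unit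
  sphere. An invertible nonnegative form is bounded below, so \<open>s\<^sup>2\<close> must be a zero of the
  characteristic polynomial.\<close>

lemma charp_spec_norm:
  assumes fin: "finite S" "finite R" and s: "spec_norm S R M > 0"
  shows "poly (charp R (col_gram S M)) ((spec_norm S R M)\<^sup>2) = 0"
proof (rule ccontr)
  define s where "s = spec_norm S R M"
  define C where "C = (\<lambda>i j. (if i = j then s\<^sup>2 else 0) - col_gram S M i j)"
  define c where "c = (\<lambda>v. s\<^sup>2 * nsq R v - nsq S (mat_app R M v))"
  assume "poly (charp R (col_gram S M)) ((spec_norm S R M)\<^sup>2) \<noteq> 0"
  then have "minor R C \<noteq> 0" by (simp add: poly_charp C_def flip: s_def)
  then obtain W where W: "\<And>v i. i \<in> R \<Longrightarrow> (\<Sum>j\<in>R. C i j * (\<Sum>l\<in>R. W j l * v l)) = v i"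
    using minor_nonzero_right_inverse[OF fin(2)] by blast
  have s0: "s > 0" using s by (simp add: s_def)
  have appC: "mat_app R C v i = s\<^sup>2 * v i - mat_app R (col_gram S M) v i" if "i \<in> R" for v i
  proof -
    have "mat_app R C v i = (\<Sum>j\<in>R. (if j = i then s\<^sup>2 * v j else 0) - col_gram S M i j * v j)"
      unfolding mat_app_def C_def by (intro sum.cong) (auto simp: algebra_simps)
    then show ?thesis using that fin by (simp add: sum_subtractf mat_app_def)
  qed
  have c_eq: "c v = (\<Sum>i\<in>R. v i * mat_app R C v i)" for v
    unfolding c_def nsq_mat_app by (simp add: appC algebra_simps sum_subtractf sum_distrib_left nsq_def power2_eq_square)
  have c_nonneg: "c v \<ge> 0" for v
    using spec_norm_bound[OF fin(2), of S M v] by (simp add: c_def s_def)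
  define K where "K = (spec_norm R R W)\<^sup>2 + 1"
  have K: "K > 0" "nsq R (mat_app R W v) \<le> K * nsq R v" for v
    using spec_norm_bound[OF fin(2), of R W v] nsq_nonneg[of R v]
    by (auto simp: K_def algebra_simps add_pos_nonneg add_nonneg_pos)
  \<comment> \<open>The first bound absorbs the quadratic term in \<epsilon> below; the second keeps
    \<open>s\<^sup>2 - \<epsilon>\<close> nonnegative for the square root.\<close>
  define \<epsilon> where "\<epsilon> = min (1 / (s\<^sup>2 * K)) (s\<^sup>2)"
  have \<epsilon>: "\<epsilon> > 0" "\<epsilon> * (s\<^sup>2 * K) \<le> 1" "\<epsilon> \<le> s\<^sup>2"
    using s0 K(1) by (auto simp: \<epsilon>_def min_def field_simps)
  have low: "\<epsilon> * nsq R v \<le> c v" for v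
  proof -
    define w where "w = mat_app R W v"
    have Cw: "mat_app R C w i = v i" if "i \<in> R" for i
      using W[OF that, of v] by (simp add: mat_app_def w_def)
    have Csym: "(\<Sum>i\<in>R. w i * mat_app R C v i) = (\<Sum>i\<in>R. v i * mat_app R C w i)"
    proof -
      have "C i j = C j i" for i j by (simp add: C_def col_gram_sym)
      then have "(\<Sum>i\<in>R. \<Sum>j\<in>R. w i * (C i j * v j)) = (\<Sum>i\<in>R. \<Sum>j\<in>R. v j * (C j i * w i))"
        by (intro sum.cong refl) (simp add: mult_ac)
      also have "\<dots> = (\<Sum>j\<in>R. \<Sum>i\<in>R. v j * (C j i * w i))" by (rule sum.swap)
      finally show ?thesis by (simp add: mat_app_def sum_distrib_left)
    qed
    have vw: "(\<Sum>i\<in>R. v i * mat_app R C w i) = nsq R v"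
      by (simp add: Cw nsq_def power2_eq_square)
    \<comment> \<open>With \<open>w\<close> the preimage of \<open>v\<close> under \<open>C\<close>,
      nonnegativity of the form at \<open>v - \<epsilon> w\<close> bounds \<open>c v\<close> from
      below by a multiple of \<open>nsq R v\<close>.\<close>
    let ?y = "\<lambda>i. v i - \<epsilon> * w i"
    have "mat_app R C ?y i = mat_app R C v i - \<epsilon> * mat_app R C w i" for i
      by (simp add: mat_app_def algebra_simps sum_subtractf sum_distrib_left)
    then have "c ?y = (\<Sum>i\<in>R. (v i - \<epsilon> * w i) * (mat_app R C v i - \<epsilon> * mat_app R C w i))"
      unfolding c_eq by simp
    also have "\<dots> = (\<Sum>i\<in>R. v i * mat_app R C v i) - \<epsilon> * (\<Sum>i\<in>R. w i * mat_app R C v i)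
        - \<epsilon> * (\<Sum>i\<in>R. v i * mat_app R C w i) + \<epsilon>\<^sup>2 * (\<Sum>i\<in>R. w i * mat_app R C w i)"
      by (simp add: algebra_simps sum_subtractf sum.distrib sum_distrib_left power2_eq_square)
    finally have "0 \<le> c v - 2 * \<epsilon> * nsq R v + \<epsilon>\<^sup>2 * c w"
      using c_nonneg[of ?y] unfolding Csym vw c_eq by simp
    also have "\<epsilon>\<^sup>2 * c w \<le> \<epsilon>\<^sup>2 * (s\<^sup>2 * (K * nsq R v))"
    proof (intro mult_left_mono)
      have "c w \<le> s\<^sup>2 * nsq R w" by (simp add: c_def nsq_nonneg)
      also have "\<dots> \<le> s\<^sup>2 * (K * nsq R v)" using K(2)[of v] by (intro mult_left_mono) (auto simp: w_def)
      finally show "c w \<le> s\<^sup>2 * (K * nsq R v)" .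
    qed auto
    also have "\<epsilon>\<^sup>2 * (s\<^sup>2 * (K * nsq R v)) = (\<epsilon> * (s\<^sup>2 * K)) * (\<epsilon> * nsq R v)"
      by (simp add: power2_eq_square mult_ac)
    also have "\<dots> \<le> 1 * (\<epsilon> * nsq R v)"
      using \<epsilon> nsq_nonneg[of R v] by (intro mult_right_mono) auto
    finally show ?thesis by simp
  qed
  \<comment> \<open>The lower bound on \<open>c\<close> makes
    \<open>sqrt (s\<^sup>2 - \<epsilon>)\<close> a valid operator bound, smaller than the norm
    \<open>s\<close> itself.\<close>
  have "s \<le> sqrt (s\<^sup>2 - \<epsilon>)"
    unfolding s_def
  proof (rule spec_norm_le)
    show "0 \<le> sqrt ((spec_norm S R M)\<^sup>2 - \<epsilon>)" using \<epsilon> by (simp add: s_def)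
    fix v
    show "nsq S (mat_app R M v) \<le> (sqrt ((spec_norm S R M)\<^sup>2 - \<epsilon>))\<^sup>2 * nsq R v"
      using low[of v] \<epsilon> by (simp add: c_def s_def algebra_simps)
  qed
  then have "s\<^sup>2 \<le> (sqrt (s\<^sup>2 - \<epsilon>))\<^sup>2" using s0 by (intro power_mono) auto
  also have "\<dots> = s\<^sup>2 - \<epsilon>" using \<epsilon> by simp
  finally have "s\<^sup>2 \<le> s\<^sup>2 - \<epsilon>" .
  then show False using \<epsilon> by simp
qed

lemma spec_norm_le_of_charp_pos:
  assumes "finite S" "finite R" "b \<ge> 0" "\<And>x. x \<ge> b\<^sup>2 \<Longrightarrow> poly (charp R (col_gram S M)) x > 0"
  shows "spec_norm S R M \<le> b"
proof (rule ccontr)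
  assume "\<not> spec_norm S R M \<le> b"
  then have "spec_norm S R M > 0" "(spec_norm S R M)\<^sup>2 \<ge> b\<^sup>2"
    using assms(3) by (auto intro!: power_mono)
  then show False using charp_spec_norm[OF assms(1,2), of M] assms(4)[of "(spec_norm S R M)\<^sup>2"] by simp
qed

section \<open>The zeros of the initial polynomial\<close>

lemma coeff_prod_linear:
  fixes r :: "nat \<Rightarrow> real"
  shows "coeff (\<Prod>i<n. [:- r i, 1:]) n = 1 \<and> degree (\<Prod>i<n. [:- r i, 1:]) = n \<and>
    (n > 0 \<longrightarrow> coeff (\<Prod>i<n. [:- r i, 1:]) (n - 1) = - (\<Sum>i<n. r i))"
proof (induction n)
  case (Suc n)
  let ?P = "\<Prod>i<n. [:- r i, 1:]"
  have eq: "(\<Prod>i<Suc n. [:- r i, 1:]) = pCons 0 ?P - Polynomial.smult (r n) ?P"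
    by (simp add: mult.commute)
  have deg: "degree (\<Prod>i<Suc n. [:- r i, 1:]) = Suc n"
    by (subst degree_prod_eq_sum_degree) auto
  have top: "coeff ?P (Suc n) = 0" using Suc by (intro coeff_eq_0) simp
  show ?case
    unfolding deg using Suc top by (cases n) (auto simp: eq)
qed simp

lemma charp_row_gram_zeros:
  assumes fin: "finite S" "finite R" and le: "spec_norm S R A \<le> 1"
  obtains r where "charp S (row_gram R A) = (\<Prod>i<card S. [:- r i, 1:])"
    "\<And>i. i < card S \<Longrightarrow> 0 \<le> r i \<and> r i \<le> 1"
    "(\<Sum>i<card S. r i) = (frob_norm S R A)\<^sup>2"
proof -
  let ?f = "charp S (row_gram R A)"
  have co: "degree ?f = card S" "lead_coeff ?f = 1"
    "card S > 0 \<Longrightarrow> coeff ?f (card S - 1) = - (\<Sum>i\<in>S. row_gram R A i i)"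
    using coeff_charp[OF fin(1) refl, of "row_gram R A"] by auto
  have st: "hp_stable (complex_poly ?f)" using fin(1) row_gram_sym by (rule hp_stable_charp)
  have "?f \<noteq> 0" using co(2) by auto
  with st obtain r where r: "?f = Polynomial.smult (lead_coeff ?f) (\<Prod>i<degree ?f. [:- r i, 1:])"
    by (rule real_rooted_of_hp_stable)
  then have f: "?f = (\<Prod>i<card S. [:- r i, 1:])" using co by simp
  have "0 \<le> r i \<and> r i \<le> 1" if i: "i < card S" for i
  proof -
    define \<rho> where "\<rho> = r i"
    have "poly ?f \<rho> = 0" unfolding f \<rho>_def poly_prod using i by (intro prod_zero) auto
    then have "minor S (\<lambda>i j. (if i = j then \<rho> else 0) - row_gram R A i j) = 0" by (simp add: poly_charp)
    from minor_zero_kernel[OF fin(1) this] obtain v where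
      v: "\<exists>i\<in>S. v i \<noteq> 0" "\<forall>i\<in>S. (\<Sum>j\<in>S. ((if i = j then \<rho> else 0) - row_gram R A i j) * v j) = 0"
      by blast
    have "nsq S v \<noteq> 0" using v(1) fin(1) by (simp add: nsq_eq_0_iff)
    then have pos: "nsq S v > 0" using nsq_nonneg[of S v] by simp
    have eig: "mat_app S (row_gram R A) v i = \<rho> * v i" if "i \<in> S" for i
    proof -
      have "(\<Sum>j\<in>S. ((if i = j then \<rho> else 0) - row_gram R A i j) * v j)
          = (\<Sum>j\<in>S. (if i = j then \<rho> * v j else 0) - row_gram R A i j * v j)"
        by (intro sum.cong) (auto simp: algebra_simps)
      also have "\<dots> = \<rho> * v i - mat_app S (row_gram R A) v i"
        using that fin(1) by (simp add: sum_subtractf mat_app_def)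
      finally show ?thesis using v(2) that by simp
    qed
    \<comment> \<open>\<open>w\<close> is the transpose of \<open>A\<close> applied to the
      eigenvector \<open>v\<close>. Then \<open>w\<close> has squared norm
      \<open>\<rho> |v|\<^sup>2\<close> and \<open>A w\<close> has squared norm
      \<open>\<rho>\<^sup>2 |v|\<^sup>2\<close>, so contractivity gives
      \<open>\<rho>\<^sup>2 \<le> \<rho>\<close>.\<close>
    define w where "w = mat_app S (\<lambda>i j. A j i) v"
    have "nsq R w = (\<Sum>i\<in>S. v i * mat_app S (row_gram R A) v i)"
      unfolding w_def nsq_mat_app by (simp add: col_gram_def row_gram_def mat_app_def)
    then have w: "nsq R w = \<rho> * nsq S v"
      by (simp add: eig nsq_def sum_distrib_left power2_eq_square mult_ac)
    have "mat_app R A w i = mat_app S (row_gram R A) v i" for i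
    proof -
      have "mat_app R A w i = (\<Sum>l\<in>R. \<Sum>j\<in>S. A i l * A j l * v j)"
        by (simp add: mat_app_def w_def sum_distrib_left mult.assoc)
      also have "\<dots> = (\<Sum>j\<in>S. \<Sum>l\<in>R. A i l * A j l * v j)" by (rule sum.swap)
      finally show ?thesis by (simp add: mat_app_def row_gram_def sum_distrib_right)
    qed
    then have "nsq S (mat_app R A w) = \<rho>\<^sup>2 * nsq S v"
      by (simp add: nsq_def eig sum_distrib_left power_mult_distrib)
    moreover have "nsq S (mat_app R A w) \<le> 1 * nsq R w"
    proof -
      have "(spec_norm S R A)\<^sup>2 \<le> 1" using le spec_norm_nonneg[OF fin(2)] by (simp add: power_le_one)
      then show ?thesis
        using spec_norm_bound[OF fin(2), of S A w] nsq_nonneg[of R w] mult_right_mono order_trans by blast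
    qed
    ultimately have "\<rho>\<^sup>2 * nsq S v \<le> \<rho> * nsq S v" using w by simp
    then have "\<rho>\<^sup>2 \<le> \<rho>" using pos by simp
    moreover have "\<rho> \<ge> 0" using w nsq_nonneg[of R w] pos by (simp add: zero_le_mult_iff)
    ultimately show ?thesis unfolding \<rho>_def[symmetric]
      by (cases "\<rho> = 0") (auto simp: power2_eq_square)
  qed
  moreover have "(\<Sum>i<card S. r i) = (frob_norm S R A)\<^sup>2"
  proof -
    have fr: "(frob_norm S R A)\<^sup>2 = (\<Sum>i\<in>S. row_gram R A i i)"
      by (simp add: frob_norm_def row_gram_def sum_nonneg power2_eq_square)
    show ?thesis
    proof (cases "card S > 0")
      case True
      have "- (\<Sum>i<card S. r i) = coeff ?f (card S - 1)"
        using coeff_prod_linear[of r "card S"] True by (simp add: f)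
      then show ?thesis using co(3)[OF True] fr by simp
    next
      case False
      then have "S = {}" using fin(1) by auto
      then show ?thesis by (simp add: frob_norm_def)
    qed
  qed
  ultimately show ?thesis using f that by blast
qed

text \<open>Convexity in \<open>r\<close>: the chord of \<open>u / (u\<^sup>2 - r)\<close> between \<open>r = 0\<close> and \<open>r = 1\<close>.\<close>

lemma chord_bound:
  fixes u r :: real
  assumes "u > 1" "0 \<le> r" "r \<le> 1"
  shows "u / (u\<^sup>2 - r) \<le> (1 - r) / u + r * u / (u\<^sup>2 - 1)"
proof -
  have U: "u\<^sup>2 > 1" using assms(1) by simp
  have "(1 - r) / u + r * u / (u\<^sup>2 - 1) - u / (u\<^sup>2 - r) = r * (1 - r) / (u * (u\<^sup>2 - 1) * (u\<^sup>2 - r))"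
  proof -
    have "u \<noteq> 0" "u\<^sup>2 - 1 \<noteq> 0" "u\<^sup>2 - r \<noteq> 0" using assms U by linarith+
    then show ?thesis by (simp add: divide_simps) (simp add: algebra_simps power2_eq_square)
  qed
  also have "\<dots> \<ge> 0" using assms U by (intro divide_nonneg_nonneg mult_nonneg_nonneg) linarith+
  finally show ?thesis by simp
qed

text \<open>The chord bound leaves only the mean \<beta>. The final bound is \<open>d\<close> times
  the Cauchy transform at \<open>u\<close> of the two-point law with mass
  \<open>\<beta> / (\<beta> + 1)\<close> at \<open>1\<close> and \<open>1 / (\<beta> + 1)\<close> at
  \<open>-\<beta>\<close>, which has mean \<open>0\<close> and variance \<beta>.\<close>

lemma barrier_initial:
  fixes r :: "nat \<Rightarrow> real"
  assumes r: "\<And>i. i < d \<Longrightarrow> 0 \<le> r i \<and> r i \<le> 1" and sum: "(\<Sum>i<d. r i) = \<beta> * d"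
    and d: "d > 0" and u: "u > 1"
  shows "(\<Sum>i<d. u / (u\<^sup>2 - r i)) \<le> d * (u - 1 + \<beta>) / ((u - 1) * (u + \<beta>))"
proof -
  have \<beta>0: "\<beta> \<ge> 0"
    using sum sum_nonneg[of "{..<d}" r] r d by (simp add: zero_le_mult_iff)
  have "(\<Sum>i<d. r i) \<le> (\<Sum>i<d. 1)" by (rule sum_mono) (use r in auto)
  then have \<beta>1: "\<beta> \<le> 1" using sum d by simp
  have U: "u\<^sup>2 > 1" using u by simp
  have "(\<Sum>i<d. u / (u\<^sup>2 - r i)) \<le> (\<Sum>i<d. (1 - r i) / u + r i * u / (u\<^sup>2 - 1))"
    by (rule sum_mono) (use chord_bound[OF u] r in auto)
  also have "\<dots> = d * ((1 - \<beta>) / u + \<beta> * u / (u\<^sup>2 - 1))"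
  proof -
    have "(\<Sum>i<d. (1 - r i) / u) = (d - \<beta> * d) / u"
      by (simp add: sum_divide_distrib[symmetric] sum_subtractf sum)
    moreover have "(\<Sum>i<d. r i * u / (u\<^sup>2 - 1)) = (\<Sum>i<d. r i) * (u / (u\<^sup>2 - 1))"
      unfolding sum_distrib_right by (intro sum.cong) auto
    ultimately have "(\<Sum>i<d. (1 - r i) / u + r i * u / (u\<^sup>2 - 1))
        = (d - \<beta> * d) / u + \<beta> * d * (u / (u\<^sup>2 - 1))"
      by (simp only: sum.distrib sum)
    also have "\<dots> = d * ((1 - \<beta>) / u + \<beta> * u / (u\<^sup>2 - 1))"
      by (simp add: algebra_simps diff_divide_distrib)
    finally show ?thesis .
  qed
  also have "(1 - \<beta>) / u + \<beta> * u / (u\<^sup>2 - 1) \<le> (u - 1 + \<beta>) / ((u - 1) * (u + \<beta>))"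
  proof -
    have "(u - 1 + \<beta>) / ((u - 1) * (u + \<beta>)) - ((1 - \<beta>) / u + \<beta> * u / (u\<^sup>2 - 1))
        = \<beta> * (1 - \<beta>) / (u * (u\<^sup>2 - 1) * (u + \<beta>))"
    proof -
      have "u\<^sup>2 - 1 = (u - 1) * (u + 1)" by (simp add: algebra_simps power2_eq_square)
      then show ?thesis using u \<beta>0
        by (simp add: divide_simps) (simp add: algebra_simps power2_eq_square)
    qed
    also have "\<dots> \<ge> 0" using \<beta>0 \<beta>1 u U by (intro divide_nonneg_nonneg mult_nonneg_nonneg) auto
    finally show ?thesis by simp
  qed
  finally show ?thesis using d by (simp add: mult_left_mono)
qed

text \<open>The optimal starting point is \<open>u = \<tau> + 1 - \<beta>\<close> with \<open>\<tau> = sqrt ((1 - p) \<beta> / p)\<close>; it satisfies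
  \<open>u > 1\<close> precisely when \<open>k < d / (\<beta> + 1)\<close>.\<close>

lemma expected_charp_pos:
  fixes f :: "real poly" and r :: "nat \<Rightarrow> real"
  assumes f: "pos_real_rooted d f" "f = (\<Prod>i<d. [:- r i, 1:])"
    and r: "\<And>i. i < d \<Longrightarrow> 0 \<le> r i \<and> r i \<le> 1" and sum: "(\<Sum>i<d. r i) = \<beta> * d"
    and \<beta>: "\<beta> > 0" and k: "0 < k" "real k < d / (\<beta> + 1)"
    and b: "b = (1 - \<beta>) * (k / d) + 2 * sqrt ((1 - k / d) * (k / d) * \<beta>)"
  shows "b > 0 \<and> (\<forall>x\<ge>b\<^sup>2. poly ((pderiv ^^ (d - k)) (monom 1 (d - k) * (pderiv ^^ (d - k)) f)) x > 0)"
proof -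
  define p where "p = real k / d"
  define n where "n = d - k"
  have kd: "real k * (\<beta> + 1) < d" using k \<beta> by (simp add: field_simps)
  have "real k * 1 \<le> real k * (\<beta> + 1)" using \<beta> by (intro mult_left_mono) auto
  then have kd': "k < d" using kd by simp
  then have d: "d > 0" by simp
  have p: "0 < p" "p < 1" "p * (\<beta> + 1) < 1" using kd kd' k d by (auto simp: p_def field_simps)
  define \<tau> where "\<tau> = sqrt ((1 - p) * \<beta> / p)"
  have \<tau>0: "\<tau> > 0" using p \<beta> by (simp add: \<tau>_def)
  have \<tau>2: "\<tau>\<^sup>2 = (1 - p) * \<beta> / p" using p \<beta> by (simp add: \<tau>_def)
  have "\<beta>\<^sup>2 < (1 - p) * \<beta> / p"
  proof -
    have "\<beta> * (p * \<beta>) < \<beta> * (1 - p)" using p \<beta> by (intro mult_strict_left_mono) (auto simp: algebra_simps)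
    then show ?thesis using p by (simp add: field_simps power2_eq_square)
  qed
  then have \<tau>\<beta>: "\<tau> > \<beta>" using \<beta> by (simp add: \<tau>_def real_less_rsqrt)
  define u where "u = \<tau> + 1 - \<beta>"
  have u: "u > 1" using \<tau>\<beta> by (simp add: u_def)
  define \<phi> where "\<phi> = d * (u - 1 + \<beta>) / ((u - 1) * (u + \<beta>))"
  have \<phi>_eq: "\<phi> = d * \<tau> / ((\<tau> - \<beta>) * (\<tau> + 1))" by (simp add: \<phi>_def u_def)
  have \<phi>: "\<phi> > 0" unfolding \<phi>_eq using \<tau>0 \<tau>\<beta> d by simp
  have sq: "sqrt ((1 - p) * p * \<beta>) = p * \<tau>"
  proof (rule real_sqrt_unique)
    show "(p * \<tau>)\<^sup>2 = (1 - p) * p * \<beta>" using p by (simp add: power_mult_distrib \<tau>2) (simp add: power2_eq_square)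
  qed (use p \<tau>0 in simp)
  \<comment> \<open>As a function of \<tau> the end point is
    \<open>p (1 - \<beta>) + p \<tau> + (1 - p) \<beta> / \<tau>\<close>; the chosen \<tau>
    equalizes the last two terms and so minimizes it.\<close>
  have "real n / \<phi> = (1 - p) * ((\<tau> - \<beta>) * (\<tau> + 1)) / \<tau>"
    unfolding \<phi>_eq n_def using kd' d by (simp add: p_def field_simps)
  also have "\<dots> = (1 - p) * (\<tau> + 1 - \<beta>) - (1 - p) * \<beta> / \<tau>"
    using \<tau>0 by (simp add: field_simps power2_eq_square)
  also have "(1 - p) * \<beta> / \<tau> = p * \<tau>"
    using \<tau>0 \<tau>2 p by (simp add: field_simps power2_eq_square)
  finally have "real n / \<phi> = (1 - p) * (\<tau> + 1 - \<beta>) - p * \<tau>" .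
  then have "u - n / \<phi> = u - ((1 - p) * (\<tau> + 1 - \<beta>) - p * \<tau>)" by (rule arg_cong)
  also have "\<dots> = p * (1 - \<beta>) + 2 * (p * \<tau>)" by (simp add: u_def algebra_simps)
  finally have shift: "u - n / \<phi> = p * (1 - \<beta>) + 2 * (p * \<tau>)" .
  have b_eq: "u - n / \<phi> = b" unfolding shift b p_def[symmetric] sq by (simp add: mult.commute)
  \<comment> \<open>In this form positivity is visible without any upper bound on \<beta>.\<close>
  have "b = p * u + p * \<tau>" using trans[OF b_eq[symmetric] shift] by (simp add: u_def algebra_simps)
  then have b0: "b > 0" using p u \<tau>0 by (simp add: add_pos_pos)
  have U: "u\<^sup>2 > 1" using u by simp
  have ru: "r i < u\<^sup>2" if "i < d" for i using r[OF that] U by simp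
  have "\<forall>x\<ge>(u - n / \<phi>)\<^sup>2. poly ((pderiv ^^ n) (monom 1 n * (pderiv ^^ n) f)) x > 0"
  proof (rule barrier_two_sided)
    show "pos_real_rooted (k + n) f" using f(1) kd' by (simp add: n_def)
    show "k \<ge> 1" "\<phi> > 0" "u > 0" "u - n / \<phi> > 0" using k \<phi> u b0 b_eq by auto
    show "poly f x > 0" if "x \<ge> u\<^sup>2" for x
      unfolding f(2) poly_prod using ru that by (intro prod_pos) force
    then have fpos: "poly f (u\<^sup>2) > 0" by simp
    have "poly (pderiv f) (u\<^sup>2) = poly f (u\<^sup>2) * (\<Sum>i<d. 1 / (u\<^sup>2 - r i))"
      using ru f(2) by (intro poly_pderiv_linear_factors[of f 1]) force+
    then have "u * poly (pderiv f) (u\<^sup>2) = poly f (u\<^sup>2) * (\<Sum>i<d. u / (u\<^sup>2 - r i))"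
      by (simp add: sum_distrib_left mult.commute)
    also have "\<dots> \<le> poly f (u\<^sup>2) * \<phi>"
      unfolding \<phi>_def using fpos by (intro mult_left_mono barrier_initial r sum d u) auto
    finally show "u * poly (pderiv f) (u\<^sup>2) \<le> \<phi> * poly f (u\<^sup>2)" by (simp add: mult.commute)
  qed
  then show ?thesis using b0 unfolding b_eq unfolding n_def by blast
qed

theorem theorem1p4:
  fixes d k :: nat and A :: "nat \<Rightarrow> nat \<Rightarrow> real" and \<beta> :: real
  assumes "spec_norm {1..d} {1..d} A \<le> 1"
    and "\<beta> = (frob_norm {1..d} {1..d} A)\<^sup>2 / real d"
    and "0 < k"
    and "real k < real d / (\<beta> + 1)"
  shows "\<exists>S R. S \<subseteq> {1..d} \<and> R \<subseteq> {1..d} \<and> card S = k \<and> card R = k \<and>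
     spec_norm S R A \<le> (1 - \<beta>) * (real k / real d)
        + 2 * sqrt ((1 - real k / real d) * (real k / real d) * \<beta>)"
proof -
  let ?D = "{1..d}"
  define b where "b = (1 - \<beta>) * (real k / real d) + 2 * sqrt ((1 - real k / real d) * (real k / real d) * \<beta>)"
  have \<beta>0: "\<beta> \<ge> 0" using assms(2) by simp
  have "d > 0" using assms(3,4) by (cases d) auto
  have "real k < real d" using assms(4) \<beta>0 \<open>d > 0\<close>
    by (smt (verit) divide_le_eq_1 frac_le of_nat_0_le_iff div_by_1)
  then have kd: "k < d" by simp
  show ?thesis
  proof (cases "\<beta> = 0")
    \<comment> \<open>The matrix vanishes on the index square and \<tau> would degenerate to
      \<open>0\<close>; any two \<open>k\<close>-sets work.\<close>
    case True
    have "(\<Sum>i\<in>?D. \<Sum>j\<in>?D. (A i j)\<^sup>2) = 0"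
      using assms(2) True \<open>d > 0\<close> by (auto simp: frob_norm_def sum_nonneg)
    then have A0: "A i j = 0" if "i \<in> ?D" "j \<in> ?D" for i j
      using that by (simp add: sum_nonneg_eq_0_iff sum_nonneg)
    have "spec_norm {1..k} {1..k} A \<le> 0"
    proof (rule spec_norm_le)
      fix v
      have "mat_app {1..k} A v i = 0" if "i \<in> {1..k}" for i
        unfolding mat_app_def using A0 that kd by (intro sum.neutral) auto
      then show "nsq {1..k} (mat_app {1..k} A v) \<le> 0\<^sup>2 * nsq {1..k} v" by (simp add: nsq_def)
    qed simp
    then have "spec_norm {1..k} {1..k} A \<le> real k / real d" by (rule order_trans) simp
    then show ?thesis
      using True kd by (intro exI[of _ "{1..k}"]) auto
  next
    case False
    have fin: "finite ?D" by simp
    obtain r where r: "charp ?D (row_gram ?D A) = (\<Prod>i<d. [:- r i, 1:])"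
      "\<And>i. i < d \<Longrightarrow> 0 \<le> r i \<and> r i \<le> 1" "(\<Sum>i<d. r i) = (frob_norm ?D ?D A)\<^sup>2"
      using charp_row_gram_zeros[OF fin fin assms(1)] by auto
    have good: "pos_real_rooted d (charp ?D (row_gram ?D A))"
      using pos_real_rooted_charp[OF fin row_gram_sym, of ?D A] by simp
    have sum: "(\<Sum>i<d. r i) = \<beta> * d" using r(3) assms(2) \<open>d > 0\<close> by simp
    define n where "n = d - k"
    have b: "b > 0" and pos: "\<And>x. x \<ge> b\<^sup>2 \<Longrightarrow>
        poly ((pderiv ^^ n) (monom 1 n * (pderiv ^^ n) (charp ?D (row_gram ?D A)))) x > 0"
      using expected_charp_pos[OF good r(1,2) sum _ assms(3,4) b_def] \<beta>0 False by (auto simp: n_def)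
    have card: "card ?D = k + n" using kd by (simp add: n_def)
    \<comment> \<open>Rows are selected first, with the \<open>n\<close> outer derivatives reserved
      for the columns.\<close>
    obtain S where S: "S \<subseteq> ?D" "card S = k"
      and posS: "\<And>x. x \<ge> b\<^sup>2 \<Longrightarrow> poly ((pderiv ^^ n) (monom 1 n * charp S (row_gram ?D A))) x > 0"
      using exists_principal_submatrix[OF row_gram_sym fin card pos] by blast
    have finS: "finite S" using S(1) finite_subset by blast
    \<comment> \<open>Passing to the column Gram matrix absorbs the factor \<open>z\<^sup>n\<close>,
      because \<open>card ?D = card S + n\<close>.\<close>
    have "charp ?D (col_gram S A) = monom 1 n * charp S (row_gram ?D A)"
      using card S(2) by (intro charp_gram finS fin) simp
    \<comment> \<open>The reserved derivatives become the inner ones of the second selection; its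
      outer operator is trivial, with exponent \<open>0\<close>.\<close>
    then have "\<And>x. x \<ge> b\<^sup>2 \<Longrightarrow> poly ((pderiv ^^ 0) (monom 1 0 * (pderiv ^^ n) (charp ?D (col_gram S A)))) x > 0"
      using posS by simp
    from exists_principal_submatrix[OF col_gram_sym fin card this]
    obtain R where R: "R \<subseteq> ?D" "card R = k" and posR: "\<And>x. x \<ge> b\<^sup>2 \<Longrightarrow> poly (charp R (col_gram S A)) x > 0"
      by auto
    have "spec_norm S R A \<le> b"
      using b finite_subset[OF R(1)] by (intro spec_norm_le_of_charp_pos finS posR) auto
    then show ?thesis using S R unfolding b_def by blast
  qed
qed

end
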